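(* Let $p$ be a prime and let $\underline{M}$ be a $C_p$-Mackey functor. Then $\underline{M}$ is invertible for the box product if and only if $\underline{M}$ is isomorphic to the twisted Burnside Mackey functor ${}_d\underline{A}$ for some $d \in \mathbb{Z}$ such that $\gcd(d,p)=1$.
   Context: Let $C_p$ be the cyclic group of prime order $p$. A $C_p$-Mackey functor $\underline{M}$ consists of an abelian group $\underline{M}( * )$, an abelian group $\underline{M}(C_p)$ with an action of $C_p$ by group automorphisms, and group homomorphisms $tr:\underline{M}(C_p)\to\underline{M}( * )$ (transfer) and $r = res:\underline{M}( * )\to\underline{M}(C_p)$ (restriction) such that for all $x\in\underline{M}( * )$, $y\in\underline{M}(C_p)$, $\gamma\in C_p$: (1) $\gamma\cdot res(x)=res(x)$; (2) $tr(\gamma\cdot y)=tr(y)$; (3) $res(tr(y))=\sum_{\gamma\in C_p}\gamma\cdot y$. A morphism $\phi:\underline{M}\to\underline{N}$ is a pair of a group homomorphism $\underline{M}( * )\to\underline{N}( * )$ and a $C_p$-equivariant group homomorphism $\underline{M}(C_p)\to\underline{N}(C_p)$ commuting with restrictions and transfers; it is an isomorphism if both maps are bijective. Box product: for $C_p$-Mackey functors $\underline{M},\underline{N}$, the Mackey functor $\underline{M}\,\Box\,\underline{N}$ has $(\underline{M}\,\Box\,\underline{N})(C_p)=\underline{M}(C_p)\otimes_{\mathbb{Z}}\underline{N}(C_p)$ with diagonal action $\gamma\cdot(a\otimes b)=\gamma a\otimes\gamma b$, and $$(\underline{M}\,\Box\,\underline{N})( * )=\Big(\big(\underline{M}( *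 )\otimes_{\mathbb{Z}}\underline{N}( * )\big)\oplus\big(\underline{M}(C_p)\otimes_{\mathbb{Z}}\underline{N}(C_p)\big)/C_p\Big)\Big/\sim,$$ where $/C_p$ denotes coinvariants (the quotient by the subgroup generated by all $\gamma\cdot z - z$), the class of $z\in\underline{M}(C_p)\otimes\underline{N}(C_p)$ in the second summand is denoted $tr(z)$ (this defines the transfer map), and $\sim$ is generated by the Frobenius reciprocity relations $x\otimes tr(y)\sim tr(r(x)\otimes y)$ for $x\in\underline{M}( * )$, $y\in\underline{N}(C_p)$, and $tr(x)\otimes y\sim tr(x\otimes r(y))$ for $x\in\underline{M}(C_p)$, $y\in\underline{N}( * )$. Restriction is given by $res(x\otimes y)=r(x)\otimes r(y)$ and $res(tr(z))=\sum_{\gamma\in C_p}\gamma\cdot z$. Twisted Burnside Mackey functors: for $d\in\mathbb{Z}$, ${}_d\underline{A}$ has ${}_d\underline{A}( * )=\mathbb{Z}\langle 1,[C_p]\rangle$ (free abelian on two generators $1$ and $[C_p]$), ${}_d\underline{A}(C_p)=\mathbb{Z}$ with trivial action, $res(1)=d$, $res([C_p])=p$, $tr(1)=[C_p]$. The Burnside Mackey functor is $\underline{A}={}_1\underline{A}$. $\underline{M}$ is invertible (for the box product) if there exists a $C_p$-Mackey functor $\underline{N}$ with $\underline{M}\,\Box\,\underline{N}$ isomorphic to $\underline{A}$. *)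

theory Defs
  imports "HOL-Algebra.Bij" "HOL-Algebra.Elementary_Groups" "HOL-Algebra.Free_Abelian_Groups"
    "HOL-Computational_Algebra.Primes"
begin

text \<open>Abelian groups are \<^locale>\<open>comm_group\<close>s, written multiplicatively as usual in HOL-Algebra:
  sums are \<^const>\<open>finprod\<close> and negation is \<^const>\<open>m_inv\<close>. The group $C_p$ is
  \<^term>\<open>integer_mod_group p\<close>, with carrier $\{0, \ldots, p - 1\}$.\<close>

section \<open>Tensor products and coinvariants\<close>

definition tensor_rel :: "'a monoid \<Rightarrow> 'b monoid \<Rightarrow> (('a \<times> 'b) \<Rightarrow>\<^sub>0 int) set" where
  "tensor_rel G H = generate (free_Abelian_group (carrier G \<times> carrier H))
     ({frag_of (x \<otimes>\<^bsub>G\<^esub> x', y) - frag_of (x, y) - frag_of (x', y) | x x' y.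
         x \<in> carrier G \<and> x' \<in> carrier G \<and> y \<in> carrier H} \<union>
      {frag_of (x, y \<otimes>\<^bsub>H\<^esub> y') - frag_of (x, y) - frag_of (x, y') | x y y'.
         x \<in> carrier G \<and> y \<in> carrier H \<and> y' \<in> carrier H})"

definition tensor :: "'a monoid \<Rightarrow> 'b monoid \<Rightarrow> (('a \<times> 'b) \<Rightarrow>\<^sub>0 int) set monoid" where
  "tensor G H = free_Abelian_group (carrier G \<times> carrier H) Mod tensor_rel G H"

definition tensor_cls :: "'a monoid \<Rightarrow> 'b monoid \<Rightarrow> (('a \<times> 'b) \<Rightarrow>\<^sub>0 int) \<Rightarrow> (('a \<times> 'b) \<Rightarrow>\<^sub>0 int) set" where
  "tensor_cls G H z = tensor_rel G H #>\<^bsub>free_Abelian_group (carrier G \<times> carrier H)\<^esub> z"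

definition pure_tensor :: "'a monoid \<Rightarrow> 'b monoid \<Rightarrow> 'a \<Rightarrow> 'b \<Rightarrow> (('a \<times> 'b) \<Rightarrow>\<^sub>0 int) set" where
  "pure_tensor G H x y = tensor_cls G H (frag_of (x, y))"

text \<open>A map out of a quotient group induced by a map \<open>f\<close> that is constant on cosets sends the
  coset \<open>c\<close> to \<^term>\<open>the_elem (f ` c)\<close>, the unique value of \<open>f\<close> on \<open>c\<close>. This convention is used
  for all induced maps below.\<close>

definition tensor_map ::
  "'a monoid \<Rightarrow> 'b monoid \<Rightarrow> 'c monoid \<Rightarrow> 'd monoid \<Rightarrow> ('a \<Rightarrow> 'c) \<Rightarrow> ('b \<Rightarrow> 'd) \<Rightarrow>
   (('a \<times> 'b) \<Rightarrow>\<^sub>0 int) set \<Rightarrow> (('c \<times> 'd) \<Rightarrow>\<^sub>0 int) set" where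
  "tensor_map G H G' H' f g c =
     the_elem ((\<lambda>z. tensor_cls G' H' (frag_extend (\<lambda>(x, y). frag_of (f x, g y)) z)) ` c)"

definition coinv_rel :: "'g monoid \<Rightarrow> 'a monoid \<Rightarrow> ('g \<Rightarrow> 'a \<Rightarrow> 'a) \<Rightarrow> 'a set" where
  "coinv_rel C G \<phi> = generate G {\<phi> \<gamma> z \<otimes>\<^bsub>G\<^esub> inv\<^bsub>G\<^esub> z | \<gamma> z. \<gamma> \<in> carrier C \<and> z \<in> carrier G}"

definition coinvariants :: "'g monoid \<Rightarrow> 'a monoid \<Rightarrow> ('g \<Rightarrow> 'a \<Rightarrow> 'a) \<Rightarrow> 'a set monoid" where
  "coinvariants C G \<phi> = G Mod coinv_rel C G \<phi>"

definition coinv_cls :: "'g monoid \<Rightarrow> 'a monoid \<Rightarrow> ('g \<Rightarrow> 'a \<Rightarrow> 'a) \<Rightarrow> 'a \<Rightarrow> 'a set" where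
  "coinv_cls C G \<phi> z = coinv_rel C G \<phi> #>\<^bsub>G\<^esub> z"

section \<open>Mackey functors for the cyclic group of order p\<close>

text \<open>\<open>m_fix M\<close> is $M(*)$ and \<open>m_und M\<close> is $M(C_p)$.\<close>

record ('a, 'b) mackey =
  m_fix :: "'a monoid"
  m_und :: "'b monoid"
  m_act :: "int \<Rightarrow> 'b \<Rightarrow> 'b"
  m_tr :: "'b \<Rightarrow> 'a"
  m_res :: "'a \<Rightarrow> 'b"

text \<open>The restriction to the carrier is there because elements of \<^const>\<open>AutoGroup\<close> are extensional
  functions; nothing is required of the action outside the carrier.\<close>

definition mackey_functor :: "nat \<Rightarrow> ('a, 'b) mackey \<Rightarrow> bool" where
  "mackey_functor p M \<longleftrightarrow>
     comm_group (m_fix M) \<and> comm_group (m_und M) \<and>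
     (\<lambda>\<gamma>. restrict (m_act M \<gamma>) (carrier (m_und M)))
        \<in> hom (integer_mod_group p) (AutoGroup (m_und M)) \<and>
     m_tr M \<in> hom (m_und M) (m_fix M) \<and>
     m_res M \<in> hom (m_fix M) (m_und M) \<and>
     (\<forall>\<gamma>\<in>carrier (integer_mod_group p). \<forall>x\<in>carrier (m_fix M).
        m_act M \<gamma> (m_res M x) = m_res M x) \<and>
     (\<forall>\<gamma>\<in>carrier (integer_mod_group p). \<forall>y\<in>carrier (m_und M).
        m_tr M (m_act M \<gamma> y) = m_tr M y) \<and>
     (\<forall>y\<in>carrier (m_und M). m_res M (m_tr M y) =
        finprod (m_und M) (\<lambda>\<gamma>. m_act M \<gamma> y) (carrier (integer_mod_group p)))"

definition mackey_hom ::
  "nat \<Rightarrow> ('a, 'b) mackey \<Rightarrow> ('c, 'd) mackey \<Rightarrow> (('a \<Rightarrow> 'c) \<times> ('b \<Rightarrow> 'd)) set" where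
  "mackey_hom p M N = {(f, g).
     f \<in> hom (m_fix M) (m_fix N) \<and> g \<in> hom (m_und M) (m_und N) \<and>
     (\<forall>\<gamma>\<in>carrier (integer_mod_group p). \<forall>y\<in>carrier (m_und M).
        g (m_act M \<gamma> y) = m_act N \<gamma> (g y)) \<and>
     (\<forall>x\<in>carrier (m_fix M). g (m_res M x) = m_res N (f x)) \<and>
     (\<forall>y\<in>carrier (m_und M). f (m_tr M y) = m_tr N (g y))}"

definition mackey_isomorphic :: "nat \<Rightarrow> ('a, 'b) mackey \<Rightarrow> ('c, 'd) mackey \<Rightarrow> bool" where
  "mackey_isomorphic p M N \<longleftrightarrow> (\<exists>(f, g)\<in>mackey_hom p M N.
     bij_betw f (carrier (m_fix M)) (carrier (m_fix N)) \<and>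
     bij_betw g (carrier (m_und M)) (carrier (m_und N)))"

section \<open>Box product\<close>

definition box_und :: "('a, 'b) mackey \<Rightarrow> ('c, 'd) mackey \<Rightarrow> (('b \<times> 'd) \<Rightarrow>\<^sub>0 int) set monoid" where
  "box_und M N = tensor (m_und M) (m_und N)"

definition box_act :: "('a, 'b) mackey \<Rightarrow> ('c, 'd) mackey \<Rightarrow>
    int \<Rightarrow> (('b \<times> 'd) \<Rightarrow>\<^sub>0 int) set \<Rightarrow> (('b \<times> 'd) \<Rightarrow>\<^sub>0 int) set" where
  "box_act M N \<gamma> = tensor_map (m_und M) (m_und N) (m_und M) (m_und N) (m_act M \<gamma>) (m_act N \<gamma>)"

definition box_sum :: "nat \<Rightarrow> ('a, 'b) mackey \<Rightarrow> ('c, 'd) mackey \<Rightarrow>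
    ((('a \<times> 'c) \<Rightarrow>\<^sub>0 int) set \<times> (('b \<times> 'd) \<Rightarrow>\<^sub>0 int) set set) monoid" where
  "box_sum p M N = tensor (m_fix M) (m_fix N) \<times>\<times>
     coinvariants (integer_mod_group p) (box_und M N) (box_act M N)"

definition box_sum_tr :: "nat \<Rightarrow> ('a, 'b) mackey \<Rightarrow> ('c, 'd) mackey \<Rightarrow>
    (('b \<times> 'd) \<Rightarrow>\<^sub>0 int) set \<Rightarrow> (('a \<times> 'c) \<Rightarrow>\<^sub>0 int) set \<times> (('b \<times> 'd) \<Rightarrow>\<^sub>0 int) set set" where
  "box_sum_tr p M N z =
     (\<one>\<^bsub>tensor (m_fix M) (m_fix N)\<^esub>,
      coinv_cls (integer_mod_group p) (box_und M N) (box_act M N) z)"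

definition box_sum_pure :: "nat \<Rightarrow> ('a, 'b) mackey \<Rightarrow> ('c, 'd) mackey \<Rightarrow>
    'a \<Rightarrow> 'c \<Rightarrow> (('a \<times> 'c) \<Rightarrow>\<^sub>0 int) set \<times> (('b \<times> 'd) \<Rightarrow>\<^sub>0 int) set set" where
  "box_sum_pure p M N x y =
     (pure_tensor (m_fix M) (m_fix N) x y,
      \<one>\<^bsub>coinvariants (integer_mod_group p) (box_und M N) (box_act M N)\<^esub>)"

definition frobenius_rel :: "nat \<Rightarrow> ('a, 'b) mackey \<Rightarrow> ('c, 'd) mackey \<Rightarrow>
    ((('a \<times> 'c) \<Rightarrow>\<^sub>0 int) set \<times> (('b \<times> 'd) \<Rightarrow>\<^sub>0 int) set set) set" where
  "frobenius_rel p M N = generate (box_sum p M N)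
     ({box_sum_pure p M N x (m_tr N y) \<otimes>\<^bsub>box_sum p M N\<^esub> inv\<^bsub>box_sum p M N\<^esub>
         box_sum_tr p M N (pure_tensor (m_und M) (m_und N) (m_res M x) y) | x y.
         x \<in> carrier (m_fix M) \<and> y \<in> carrier (m_und N)} \<union>
      {box_sum_pure p M N (m_tr M x) y \<otimes>\<^bsub>box_sum p M N\<^esub> inv\<^bsub>box_sum p M N\<^esub>
         box_sum_tr p M N (pure_tensor (m_und M) (m_und N) x (m_res N y)) | x y.
         x \<in> carrier (m_und M) \<and> y \<in> carrier (m_fix N)})"

definition box_norm :: "nat \<Rightarrow> ('a, 'b) mackey \<Rightarrow> ('c, 'd) mackey \<Rightarrow>
    (('b \<times> 'd) \<Rightarrow>\<^sub>0 int) set \<Rightarrow> (('b \<times> 'd) \<Rightarrow>\<^sub>0 int) set" where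
  "box_norm p M N z =
     finprod (box_und M N) (\<lambda>\<gamma>. box_act M N \<gamma> z) (carrier (integer_mod_group p))"

definition box_sum_res :: "nat \<Rightarrow> ('a, 'b) mackey \<Rightarrow> ('c, 'd) mackey \<Rightarrow>
    (('a \<times> 'c) \<Rightarrow>\<^sub>0 int) set \<times> (('b \<times> 'd) \<Rightarrow>\<^sub>0 int) set set \<Rightarrow> (('b \<times> 'd) \<Rightarrow>\<^sub>0 int) set" where
  "box_sum_res p M N = (\<lambda>(u, v).
     tensor_map (m_fix M) (m_fix N) (m_und M) (m_und N) (m_res M) (m_res N) u
     \<otimes>\<^bsub>box_und M N\<^esub> the_elem (box_norm p M N ` v))"

definition mackey_box :: "nat \<Rightarrow> ('a, 'b) mackey \<Rightarrow> ('c, 'd) mackey \<Rightarrow>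
    (((('a \<times> 'c) \<Rightarrow>\<^sub>0 int) set \<times> (('b \<times> 'd) \<Rightarrow>\<^sub>0 int) set set) set, (('b \<times> 'd) \<Rightarrow>\<^sub>0 int) set) mackey" where
  "mackey_box p M N = \<lparr>
     m_fix = box_sum p M N Mod frobenius_rel p M N,
     m_und = box_und M N,
     m_act = box_act M N,
     m_tr = (\<lambda>z. frobenius_rel p M N #>\<^bsub>box_sum p M N\<^esub> box_sum_tr p M N z),
     m_res = (\<lambda>c. the_elem (box_sum_res p M N ` c))\<rparr>"

section \<open>Twisted Burnside Mackey functors and invertibility\<close>

text \<open>The pair \<open>(a, b)\<close> stands for $a \cdot 1 + b \cdot [C_p]$.\<close>

definition twisted_burnside :: "nat \<Rightarrow> int \<Rightarrow> (int \<times> int, int) mackey" where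
  "twisted_burnside p d = \<lparr>
     m_fix = integer_group \<times>\<times> integer_group,
     m_und = integer_group,
     m_act = (\<lambda>\<gamma> n. n),
     m_tr = (\<lambda>n. (0, n)),
     m_res = (\<lambda>(a, b). a * d + b * int p)\<rparr>"

definition burnside :: "nat \<Rightarrow> (int \<times> int, int) mackey" where
  "burnside p = twisted_burnside p 1"

text \<open>HOL cannot quantify existentially over types, so the types \<open>'c\<close> and \<open>'d\<close> that hold the
  elements of the candidate inverse are explicit parameters. They must be infinite to hold any
  inverse at all, since an inverse has infinite value groups.\<close>

definition mackey_invertible ::
  "'c itself \<Rightarrow> 'd itself \<Rightarrow> nat \<Rightarrow> ('a, 'b) mackey \<Rightarrow> bool" where
  "mackey_invertible _ _ p M \<longleftrightarrow>
     (\<exists>N :: ('c, 'd) mackey. mackey_functor p N \<and> mackey_isomorphic p (mackey_box p M N) (burnside p))"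

end

theory Submission
  imports Defs "HOL-Algebra.Weak_Morphisms"
begin

text \<open>
  Let $\Phi(M) = M(*) / tr(M(C_p))$. If $M \Box N \cong A$, then
  $M(C_p) \otimes N(C_p) \cong A(C_p) = \mathbb{Z}$ and
  $\Phi(M) \otimes \Phi(N) \cong \Phi(A) = \mathbb{Z}$. An abelian group $P$ with
  $P \otimes Q \cong \mathbb{Z}$ is infinite cyclic: write $\beta(x, y)$ for the image of
  $x \otimes y$; for fixed $x'$ the bilinear map $(x, y) \mapsto \beta(x', y) x$ into $P$ factors
  through $\mathbb{Z}$, so $\beta(x', y) x = \beta(x, y) s$ for some $s \in P$, and this makes
  $x \mapsto \beta(x, y)$ injective as soon as $\beta(x', y) \neq 0$. Hence $M(C_p)$ and $\Phi(M)$
  are infinite cyclic. Since the restriction of $A$ is onto, some restriction in $M$ is prime to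
  $p$; this forces the action on $M(C_p)$ to be trivial, and a lift to $M(*)$ of a generator of
  $\Phi(M)$ together with the transfer of a generator of $M(C_p)$ identifies $M$ with some
  ${}_d A$.

  Conversely, if $d e = 1 + p k$, then ${}_d A \Box {}_e A \cong A$ by sending $1 \otimes 1$ to
  $1 + k [C_p]$.
\<close>

section \<open>Homomorphisms out of quotients\<close>

text \<open>Injectivity of x \<mapsto> \<beta>(x, y) rests on torsion-freeness of P. If n x = 0 with
  n \<noteq> 0, then n \<beta>(x, y) = 0 for all y, so \<beta>(x, y) = 0, and the relation with s
  gives \<beta>(x', y) x = 0 for all x' and y; since the values of \<beta> generate the integers, x
  = 0. An injective map to the integers need not be onto, so it is divided by a generator of its
  image. The tensor product of the two quotients by transfers is never formed. The argument is
  stated for a pairing on a group modulo a subgroup: the trivial subgroup for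
  \<open>m_und M\<close>, the transfer image for \<open>m_fix M\<close>. In the second case the
  pairing is the coefficient of 1 in the image of x \<otimes> y, and it kills transfers by Frobenius
  reciprocity. The correction k [C_p] is forced by restriction: 1 \<otimes> 1 restricts to d e = 1 +
  p k, while 1 + j [C_p] in the Burnside functor restricts to 1 + p j.\<close>

lemma generate_subset_kernel:
  assumes "group_hom G H h" "S \<subseteq> carrier G" "\<And>s. s \<in> S \<Longrightarrow> h s = \<one>\<^bsub>H\<^esub>"
  shows "generate G S \<subseteq> kernel G H h"
proof -
  interpret group_hom G H h by fact
  show ?thesis
    by (rule G.generate_subgroup_incl[OF _ subgroup_kernel])
      (use assms in \<open>auto simp: kernel_def\<close>)
qed

text \<open>A homomorphism that kills \<open>K\<close> is constant on each coset of
  \<open>K\<close>, so its image there is a singleton. Every map defined through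
  \<open>the_elem\<close> is evaluated by this lemma or its consequences.\<close>

lemma the_elem_image_r_coset:
  assumes "group_hom G H h" "subgroup K G" "K \<subseteq> kernel G H h" "z \<in> carrier G"
  shows "the_elem (h ` (K #>\<^bsub>G\<^esub> z)) = h z"
proof -
  interpret group_hom G H h by fact
  have "\<one>\<^bsub>G\<^esub> \<in> K" and K: "\<And>k. k \<in> K \<Longrightarrow> k \<in> carrier G \<and> h k = \<one>\<^bsub>H\<^esub>"
    using assms by (auto simp: subgroup_def kernel_def)
  then have "h ` (K #>\<^bsub>G\<^esub> z) = {h z}"
    using assms(4) by (force simp: r_coset_def)
  then show ?thesis by simp
qed

lemma the_elem_image_hom_FactGroup:
  assumes "comm_group G" "group_hom G H h" "subgroup K G" "K \<subseteq> kernel G H h"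
  shows "(\<lambda>c. the_elem (h ` c)) \<in> hom (G Mod K) H"
proof -
  interpret comm_group G by fact
  interpret h: group_hom G H h by fact
  have "K \<lhd> G"
    using assms(3) by (simp add: normal_iff_subgroup)
  then obtain g where g: "g \<in> hom (G Mod K) H" "\<And>x. x \<in> carrier G \<Longrightarrow> g (K #>\<^bsub>G\<^esub> x) = h x"
    using h.FactGroup_universal_kernel[OF _ assms(4)] by blast
  have eq: "the_elem (h ` c) = g c" if "c \<in> carrier (G Mod K)" for c
    using that g(2) the_elem_image_r_coset[OF assms(2-4)] by (auto simp: carrier_FactGroup)
  interpret Q: group "G Mod K"
    using \<open>K \<lhd> G\<close> by (rule normal.factorgroup_is_group)
  show ?thesis
    using g(1) eq Q.m_closed unfolding hom_def by (simp add: Pi_iff)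
qed

lemma (in comm_group) r_coset_hom_FactGroup:
  assumes "subgroup K G"
  shows "(\<lambda>a. K #> a) \<in> hom G (G Mod K)"
  by (rule normal.r_coset_hom_Mod) (simp add: assms normal_iff_subgroup)

lemma (in comm_group) r_coset_int_pow_FactGroup:
  assumes "subgroup K G" "x \<in> carrier G"
  shows "(K #> x) [^]\<^bsub>G Mod K\<^esub> (n :: int) = K #> (x [^] n)"
  by (rule normal.FactGroup_int_pow) (simp_all add: assms normal_iff_subgroup)

lemma comm_group_DirProd:
  assumes "comm_group G" "comm_group H"
  shows "comm_group (G \<times>\<times> H)"
proof -
  interpret G: comm_group G by fact
  interpret H: comm_group H by fact
  show ?thesis
    by (rule group.group_comm_groupI)
      (auto simp: DirProd_group G.m_comm H.m_comm G.group_axioms H.group_axioms)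
qed

lemma (in comm_group) finprod_hom:
  assumes "comm_group H" "h \<in> hom G H" "f \<in> A \<rightarrow> carrier G"
  shows "h (finprod G f A) = finprod H (\<lambda>a. h (f a)) A"
proof -
  interpret H: comm_group H by fact
  interpret h: group_hom G H h
    using assms by unfold_locales
  show ?thesis using assms(3)
  proof (induction A rule: infinite_finite_induct)
    case (insert a A)
    then have "f a \<in> carrier G" "f \<in> A \<rightarrow> carrier G" by auto
    then show ?case using insert
      by (subst finprod_insert, simp_all)
         (subst H.finprod_insert, auto simp: h.hom_mult Pi_iff)
  qed auto
qed

lemma hom_DirProd_mult:
  assumes "comm_group T" "group_hom G T f" "group_hom H T g"
  shows "group_hom (G \<times>\<times> H) T (\<lambda>(u, v). f u \<otimes>\<^bsub>T\<^esub> g v)"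
proof -
  interpret T: comm_group T by fact
  interpret f: group_hom G T f by fact
  interpret g: group_hom H T g by fact
  show ?thesis
    by (intro group_hom.intro group_hom_axioms.intro DirProd_group T.group_axioms
        f.G.group_axioms g.G.group_axioms homI)
      (auto simp: T.m_ac)
qed

lemma (in comm_group) r_coset_eqI:
  assumes "subgroup K G" "a \<in> carrier G" "b \<in> carrier G" "a \<otimes> inv b \<in> K"
  shows "K #> a = K #> b"
proof -
  have "a \<in> K #> b"
    using assms subgroup.rcos_module_rev[OF assms(1) is_group assms(3,2)] by simp
  then show ?thesis
    using repr_independence[OF _ assms(3,1)] by metis
qed

section \<open>Tensor products\<close>

definition bilinear_map ::
  "('a, 'm) monoid_scheme \<Rightarrow> ('b, 'n) monoid_scheme \<Rightarrow> ('t, 'k) monoid_scheme \<Rightarrow> ('a \<Rightarrow> 'b \<Rightarrow> 't) \<Rightarrow> bool" where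
  "bilinear_map G H T B \<longleftrightarrow> (\<forall>x\<in>carrier G. B x \<in> hom H T) \<and> (\<forall>y\<in>carrier H. (\<lambda>x. B x y) \<in> hom G T)"

locale tensor_pair = G: comm_group G + H: comm_group H
  for G :: "'a monoid" and H :: "'b monoid"
begin

abbreviation free where "free \<equiv> free_Abelian_group (carrier G \<times> carrier H)"
abbreviation pure where "pure \<equiv> pure_tensor G H"

sublocale free: comm_group free
  by (rule abelian_free_Abelian_group)

lemma keys_diff3:
  assumes "a \<in> S" "b \<in> S" "c \<in> S"
  shows "Poly_Mapping.keys (frag_of a - frag_of b - frag_of c) \<subseteq> S"
proof -
  have "Poly_Mapping.keys (frag_of a - frag_of b - frag_of c)
    \<subseteq> Poly_Mapping.keys (frag_of a) \<union> Poly_Mapping.keys (frag_of b) \<union> Poly_Mapping.keys (frag_of c)"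
    using keys_diff[of "frag_of a - frag_of b" "frag_of c"] keys_diff[of "frag_of a" "frag_of b"] by blast
  then show ?thesis using assms by auto
qed

lemma tensor_gens_carrier:
  "{frag_of (x \<otimes>\<^bsub>G\<^esub> x', y) - frag_of (x, y) - frag_of (x', y) | x x' y.
      x \<in> carrier G \<and> x' \<in> carrier G \<and> y \<in> carrier H} \<union>
   {frag_of (x, y \<otimes>\<^bsub>H\<^esub> y') - frag_of (x, y) - frag_of (x, y') | x y y'.
      x \<in> carrier G \<and> y \<in> carrier H \<and> y' \<in> carrier H} \<subseteq> carrier free"
  by (intro Un_least subsetI; elim CollectE exE conjE; simp only: carrier_free_Abelian_group_iff;
      intro keys_diff3; simp)

lemma subgroup_tensor_rel: "subgroup (tensor_rel G H) free"
  unfolding tensor_rel_def using tensor_gens_carrier by (rule free.generate_is_subgroup)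

sublocale tensor: comm_group "tensor G H"
  unfolding tensor_def using subgroup_tensor_rel by (rule free.abelian_FactGroup)

lemma tensor_cls_hom: "tensor_cls G H \<in> hom free (tensor G H)"
  unfolding tensor_cls_def[abs_def] tensor_def
  using subgroup_tensor_rel by (rule free.r_coset_hom_FactGroup)

sublocale cls: group_hom free "tensor G H" "tensor_cls G H"
  by unfold_locales (rule tensor_cls_hom)

lemma carrier_tensor: "carrier (tensor G H) = tensor_cls G H ` carrier free"
  by (simp add: tensor_def tensor_cls_def carrier_FactGroup)

lemma pure_closed [simp]: "x \<in> carrier G \<Longrightarrow> y \<in> carrier H \<Longrightarrow> pure x y \<in> carrier (tensor G H)"
  unfolding pure_tensor_def by (rule cls.hom_closed) simp

lemma tensor_rel_cls: "r \<in> tensor_rel G H \<Longrightarrow> tensor_cls G H r = \<one>\<^bsub>tensor G H\<^esub>"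
  using free.coset_join2[OF _ subgroup_tensor_rel] subgroup.mem_carrier[OF subgroup_tensor_rel]
  by (simp add: tensor_cls_def tensor_def)

text \<open>Both families of generators of \<open>tensor_rel\<close> have the shape a - b - c, so
  this one fact gives additivity of pure tensors in either variable.\<close>

lemma tensor_cls_diff3:
  assumes "a \<in> carrier G \<times> carrier H" "b \<in> carrier G \<times> carrier H" "c \<in> carrier G \<times> carrier H"
    "frag_of a - frag_of b - frag_of c \<in> tensor_rel G H"
  shows "tensor_cls G H (frag_of a) = tensor_cls G H (frag_of b) \<otimes>\<^bsub>tensor G H\<^esub> tensor_cls G H (frag_of c)"
proof -
  have c: "frag_of a \<in> carrier free" "frag_of b \<in> carrier free" "frag_of c \<in> carrier free"
    using assms by auto
  \<comment> \<open>The first summand has trivial class, so the class of a is that of b + c.\<close>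
  have "frag_of a = (frag_of a - frag_of b - frag_of c) \<otimes>\<^bsub>free\<^esub> (frag_of b \<otimes>\<^bsub>free\<^esub> frag_of c)"
    by simp
  also have "tensor_cls G H \<dots> = tensor_cls G H (frag_of b) \<otimes>\<^bsub>tensor G H\<^esub> tensor_cls G H (frag_of c)"
    using c assms subgroup.mem_carrier[OF subgroup_tensor_rel assms(4)]
    by (subst cls.hom_mult)
      (simp_all only: free.m_closed cls.hom_mult tensor_rel_cls cls.hom_closed tensor.m_closed tensor.l_one)
  finally show ?thesis .
qed

lemma bilinear_map_pure: "bilinear_map G H (tensor G H) pure"
  unfolding bilinear_map_def
proof (intro conjI ballI homI)
  fix x y y' assume "x \<in> carrier G" "y \<in> carrier H" "y' \<in> carrier H"
  then show "pure x (y \<otimes>\<^bsub>H\<^esub> y') = pure x y \<otimes>\<^bsub>tensor G H\<^esub> pure x y'"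
    unfolding pure_tensor_def tensor_rel_def
    by (intro tensor_cls_diff3) (auto simp: tensor_rel_def intro!: generate.incl)
next
  fix y x x' assume "y \<in> carrier H" "x \<in> carrier G" "x' \<in> carrier G"
  then show "pure (x \<otimes>\<^bsub>G\<^esub> x') y = pure x y \<otimes>\<^bsub>tensor G H\<^esub> pure x' y"
    unfolding pure_tensor_def tensor_rel_def
    by (intro tensor_cls_diff3) (auto simp: tensor_rel_def intro!: generate.incl)
qed simp_all

lemma group_hom_pure_left: "x \<in> carrier G \<Longrightarrow> group_hom H (tensor G H) (pure x)"
  using bilinear_map_pure unfolding bilinear_map_def
  by (intro group_hom.intro group_hom_axioms.intro H.group_axioms tensor.group_axioms) auto

lemma group_hom_pure_right: "y \<in> carrier H \<Longrightarrow> group_hom G (tensor G H) (\<lambda>x. pure x y)"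
  using bilinear_map_pure unfolding bilinear_map_def
  by (intro group_hom.intro group_hom_axioms.intro G.group_axioms tensor.group_axioms) auto

text \<open>Closure under differences covers zero as well, since zero is a pure tensor minus itself.
  The form follows \<open>free_Abelian_group_induct\<close>.\<close>

lemma tensor_induct [consumes 1, case_names pure diff]:
  assumes "z \<in> carrier (tensor G H)"
    and pure: "\<And>x y. x \<in> carrier G \<Longrightarrow> y \<in> carrier H \<Longrightarrow> P (pure x y)"
    and diff: "\<And>a b. a \<in> carrier (tensor G H) \<Longrightarrow> b \<in> carrier (tensor G H) \<Longrightarrow> P a \<Longrightarrow> P b \<Longrightarrow>
      P (a \<otimes>\<^bsub>tensor G H\<^esub> inv\<^bsub>tensor G H\<^esub> b)"
  shows "P z"
proof -
  obtain c where c: "Poly_Mapping.keys c \<subseteq> carrier G \<times> carrier H" and z: "z = tensor_cls G H c"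
    using assms(1) unfolding carrier_tensor by auto
  show ?thesis unfolding z using c
  proof (induction c rule: free_Abelian_group_induct[consumes 1])
    case 1
    have "P (pure \<one>\<^bsub>G\<^esub> \<one>\<^bsub>H\<^esub> \<otimes>\<^bsub>tensor G H\<^esub> inv\<^bsub>tensor G H\<^esub> pure \<one>\<^bsub>G\<^esub> \<one>\<^bsub>H\<^esub>)"
      by (intro diff pure pure_closed) auto
    then show ?case
      using cls.hom_one by simp
  next
    case (2 x y)
    then have c: "x \<in> carrier free" "y \<in> carrier free" by auto
    then have "x - y = x \<otimes>\<^bsub>free\<^esub> inv\<^bsub>free\<^esub> y"
      by simp
    then have "tensor_cls G H (x - y) = tensor_cls G H x \<otimes>\<^bsub>tensor G H\<^esub> inv\<^bsub>tensor G H\<^esub> tensor_cls G H y"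
      using c by (metis cls.hom_mult cls.hom_inv free.inv_closed)
    then show ?case
      using 2 c by (simp only:) (intro diff cls.hom_closed)
  next
    case (3 a)
    then show ?case
      using pure[of "fst a" "snd a"] by (auto simp: pure_tensor_def)
  qed
qed

lemma tensor_hom_eqI:
  assumes "group_hom (tensor G H) T h" "group_hom (tensor G H) T k"
    and "\<And>x y. x \<in> carrier G \<Longrightarrow> y \<in> carrier H \<Longrightarrow> h (pure x y) = k (pure x y)"
    and "z \<in> carrier (tensor G H)"
  shows "h z = k z"
proof -
  interpret h: group_hom "tensor G H" T h by fact
  interpret k: group_hom "tensor G H" T k by fact
  show ?thesis
    using assms(4) by (induction z rule: tensor_induct) (auto simp: assms(3))
qed

lemma tensor_rel_kernel:
  assumes "group_hom free T h" "bilinear_map G H T B"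
    and hB: "\<And>x y. x \<in> carrier G \<Longrightarrow> y \<in> carrier H \<Longrightarrow> h (frag_of (x, y)) = B x y"
  shows "tensor_rel G H \<subseteq> kernel free T h"
proof -
  interpret h: group_hom free T h by fact
  have *: "h (frag_of a - frag_of b - frag_of c) = \<one>\<^bsub>T\<^esub>"
    if "a \<in> carrier G \<times> carrier H" "b \<in> carrier G \<times> carrier H" "c \<in> carrier G \<times> carrier H"
      "h (frag_of a) = h (frag_of b) \<otimes>\<^bsub>T\<^esub> h (frag_of c)" for a b c
  proof -
    have c: "frag_of a \<in> carrier free" "frag_of b \<in> carrier free" "frag_of c \<in> carrier free"
      "frag_of a - frag_of b - frag_of c \<in> carrier free"
      using that by (simp_all add: keys_diff3)
    \<comment> \<open>Applying \<open>h\<close> to this decomposition shows that the value at a - b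
      - c fixes \<open>h (frag_of a)\<close> under multiplication; cancellation makes it
      trivial.\<close>
    have "frag_of a = (frag_of a - frag_of b - frag_of c) \<otimes>\<^bsub>free\<^esub> (frag_of b \<otimes>\<^bsub>free\<^esub> frag_of c)"
      by simp
    then have "h (frag_of a) = h (frag_of a - frag_of b - frag_of c) \<otimes>\<^bsub>T\<^esub> h (frag_of a)"
      using c that(4) by (metis free.m_closed h.hom_mult)
    then show ?thesis
      using c by (metis h.H.r_cancel_one' h.hom_closed)
  qed
  show ?thesis
    unfolding tensor_rel_def
    by (rule generate_subset_kernel[OF assms(1) tensor_gens_carrier])
      (use assms(2) in \<open>auto intro!: * simp: hB bilinear_map_def hom_def\<close>)
qed

text \<open>Bilinearity of \<open>B\<close> makes its linear extension to the free group kill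
  \<open>tensor_rel\<close>.\<close>

lemma tensor_universal:
  assumes "comm_group T" "bilinear_map G H T B"
  obtains h where "group_hom (tensor G H) T h"
    "\<And>x y. x \<in> carrier G \<Longrightarrow> y \<in> carrier H \<Longrightarrow> h (pure x y) = B x y"
proof -
  interpret T: comm_group T by fact
  have "(\<lambda>(x, y). B x y) ` (carrier G \<times> carrier H) \<subseteq> carrier T"
    using assms(2) by (auto simp: bilinear_map_def hom_def)
  then obtain k where k: "k \<in> hom free T"
    "\<And>xy. xy \<in> carrier G \<times> carrier H \<Longrightarrow> k (frag_of xy) = (\<lambda>(x, y). B x y) xy"
    using T.free_Abelian_group_universal by (metis (no_types, lifting))
  then have gk: "group_hom free T k"
    by unfold_locales
  have ker: "tensor_rel G H \<subseteq> kernel free T k"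
    by (rule tensor_rel_kernel[OF gk assms(2)]) (simp add: k(2))
  have "tensor_rel G H \<lhd> free"
    using subgroup_tensor_rel free.normal_iff_subgroup by blast
  then obtain h where "h \<in> hom (tensor G H) T"
    "\<And>x. x \<in> carrier free \<Longrightarrow> h (tensor_cls G H x) = k x"
    using group_hom.FactGroup_universal_kernel[OF gk _ ker]
    unfolding tensor_def tensor_cls_def by metis
  then show thesis
    by (intro that[of h]) (auto simp: pure_tensor_def k(2) intro!: group_hom.intro group_hom_axioms.intro
      tensor.group_axioms T.group_axioms)
qed

end

lemma bilinear_map_compose:
  assumes "bilinear_map G' H' T B" "f \<in> hom G G'" "g \<in> hom H H'"
  shows "bilinear_map G H T (\<lambda>x y. B (f x) (g y))"
  using assms by (auto simp: bilinear_map_def hom_def Pi_iff)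

text \<open>On generators of the free group the defining formula is (x, y) \<mapsto> f x \<otimes> g
  y. This is bilinear, so its extension kills \<open>tensor_rel\<close> and the
  \<open>the_elem\<close> convention applies.\<close>

lemma tensor_map_properties:
  assumes "tensor_pair G H" "tensor_pair G' H'" "f \<in> hom G G'" "g \<in> hom H H'"
  shows group_hom_tensor_map: "group_hom (tensor G H) (tensor G' H') (tensor_map G H G' H' f g)"
    and tensor_map_pure: "\<And>x y. x \<in> carrier G \<Longrightarrow> y \<in> carrier H \<Longrightarrow>
      tensor_map G H G' H' f g (pure_tensor G H x y) = pure_tensor G' H' (f x) (g y)"
proof -
  interpret A: tensor_pair G H by fact
  interpret B: tensor_pair G' H' by fact
  define k where "k z = tensor_cls G' H' (frag_extend (\<lambda>(x, y). frag_of (f x, g y)) z)" for z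
  have carr: "frag_extend (\<lambda>(x, y). frag_of (f x, g y)) z \<in> carrier B.free" if "z \<in> carrier A.free" for z
  proof -
    have "Poly_Mapping.keys (frag_extend (\<lambda>(x, y). frag_of (f x, g y)) z) \<subseteq>
      (\<Union>xy \<in> Poly_Mapping.keys z. Poly_Mapping.keys ((\<lambda>(x, y). frag_of (f x, g y)) xy))"
      by (rule keys_frag_extend)
    also have "\<dots> \<subseteq> carrier G' \<times> carrier H'"
      using that assms(3,4) by (fastforce simp: hom_def)
    finally show ?thesis by simp
  qed
  have "k \<in> hom A.free (tensor G' H')"
  proof (rule homI)
    fix x y assume xy: "x \<in> carrier A.free" "y \<in> carrier A.free"
    show "k (x \<otimes>\<^bsub>A.free\<^esub> y) = k x \<otimes>\<^bsub>tensor G' H'\<^esub> k y"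
      unfolding k_def using B.cls.hom_mult[OF carr[OF xy(1)] carr[OF xy(2)]]
      by (simp add: frag_extend_add)
  qed (auto simp: k_def intro!: B.cls.hom_closed carr)
  then have k: "group_hom A.free (tensor G' H') k"
    by unfold_locales
  have pure: "k (frag_of (x, y)) = pure_tensor G' H' (f x) (g y)" for x y
    by (simp add: k_def pure_tensor_def)
  have ker: "tensor_rel G H \<subseteq> kernel A.free (tensor G' H') k"
    using bilinear_map_compose[OF B.bilinear_map_pure assms(3,4)]
    by (intro A.tensor_rel_kernel[OF k]) (auto simp: pure)
  have eq: "tensor_map G H G' H' f g = (\<lambda>c. the_elem (k ` c))"
    by (simp add: tensor_map_def k_def fun_eq_iff)
  show "group_hom (tensor G H) (tensor G' H') (tensor_map G H G' H' f g)"
    unfolding eq using the_elem_image_hom_FactGroup[OF A.free.comm_group_axioms k A.subgroup_tensor_rel ker]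
    by unfold_locales (simp add: tensor_def)
  show "tensor_map G H G' H' f g (pure_tensor G H x y) = pure_tensor G' H' (f x) (g y)"
    if "x \<in> carrier G" "y \<in> carrier H" for x y
    unfolding eq using the_elem_image_r_coset[OF k A.subgroup_tensor_rel ker, of "frag_of (x, y)"] that
    by (simp add: pure pure_tensor_def[of G H] tensor_cls_def)
qed

section \<open>Coinvariants\<close>

locale coinvariants_setting = G: comm_group G
  for G :: "'a monoid" and C :: "'g monoid" and \<phi> :: "'g \<Rightarrow> 'a \<Rightarrow> 'a" +
  assumes action_closed: "\<And>\<gamma> z. \<gamma> \<in> carrier C \<Longrightarrow> z \<in> carrier G \<Longrightarrow> \<phi> \<gamma> z \<in> carrier G"
begin

lemma coinv_gens_carrier:
  "{\<phi> \<gamma> z \<otimes>\<^bsub>G\<^esub> inv\<^bsub>G\<^esub> z | \<gamma> z. \<gamma> \<in> carrier C \<and> z \<in> carrier G} \<subseteq> carrier G"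
  using action_closed by auto

lemma subgroup_coinv_rel: "subgroup (coinv_rel C G \<phi>) G"
  unfolding coinv_rel_def using coinv_gens_carrier by (rule G.generate_is_subgroup)

lemma comm_group_coinvariants: "comm_group (coinvariants C G \<phi>)"
  unfolding coinvariants_def using subgroup_coinv_rel by (rule G.abelian_FactGroup)

sublocale coinv: comm_group "coinvariants C G \<phi>"
  by (rule comm_group_coinvariants)

sublocale cls: group_hom G "coinvariants C G \<phi>" "coinv_cls C G \<phi>"
  using G.r_coset_hom_FactGroup[OF subgroup_coinv_rel]
  by unfold_locales (simp add: coinv_cls_def[abs_def] coinvariants_def)

lemma carrier_coinvariants: "carrier (coinvariants C G \<phi>) = coinv_cls C G \<phi> ` carrier G"
  by (simp add: coinvariants_def coinv_cls_def carrier_FactGroup)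

lemma coinv_rel_kernel:
  assumes "group_hom G T k" "\<And>\<gamma> z. \<gamma> \<in> carrier C \<Longrightarrow> z \<in> carrier G \<Longrightarrow> k (\<phi> \<gamma> z) = k z"
  shows "coinv_rel C G \<phi> \<subseteq> kernel G T k"
proof -
  interpret k: group_hom G T k by fact
  show ?thesis
    unfolding coinv_rel_def
    by (rule generate_subset_kernel[OF assms(1) coinv_gens_carrier])
      (auto simp: assms(2) action_closed)
qed

lemma
  assumes "group_hom G T k" "\<And>\<gamma> z. \<gamma> \<in> carrier C \<Longrightarrow> z \<in> carrier G \<Longrightarrow> k (\<phi> \<gamma> z) = k z"
  shows group_hom_coinvariants_induced: "group_hom (coinvariants C G \<phi>) T (\<lambda>c. the_elem (k ` c))"
    and coinvariants_induced_cls: "\<And>z. z \<in> carrier G \<Longrightarrow> the_elem (k ` coinv_cls C G \<phi> z) = k z"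
proof -
  interpret k: group_hom G T k by fact
  show "group_hom (coinvariants C G \<phi>) T (\<lambda>c. the_elem (k ` c))"
    using the_elem_image_hom_FactGroup[OF G.comm_group_axioms assms(1) subgroup_coinv_rel
        coinv_rel_kernel[OF assms]]
    by unfold_locales (auto simp: coinvariants_def)
  show "the_elem (k ` coinv_cls C G \<phi> z) = k z" if "z \<in> carrier G" for z
    using the_elem_image_r_coset[OF assms(1) subgroup_coinv_rel coinv_rel_kernel[OF assms] that]
    by (simp add: coinv_cls_def)
qed

end

section \<open>Mackey functors and their box product\<close>

locale cp_mackey =
  fixes p :: nat and M :: "('a, 'b) mackey"
  assumes p_pos: "p > 0" and mackey: "mackey_functor p M"
begin

sublocale fx: comm_group "m_fix M"
  using mackey by (simp add: mackey_functor_def)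

sublocale ud: comm_group "m_und M"
  using mackey by (simp add: mackey_functor_def)

sublocale tr: group_hom "m_und M" "m_fix M" "m_tr M"
  using mackey by unfold_locales (simp add: mackey_functor_def)

sublocale res: group_hom "m_fix M" "m_und M" "m_res M"
  using mackey by unfold_locales (simp add: mackey_functor_def)

abbreviation Cp where "Cp \<equiv> integer_mod_group p"

lemma finite_Cp [simp]: "finite (carrier Cp)"
  using p_pos by (simp add: carrier_integer_mod_group)

lemma card_Cp [simp]: "card (carrier Cp) = p"
  using p_pos by (simp add: carrier_integer_mod_group)

lemma act_in_AutoGroup:
  "(\<lambda>\<gamma>. restrict (m_act M \<gamma>) (carrier (m_und M))) \<in> hom Cp (AutoGroup (m_und M))"
  using mackey by (simp add: mackey_functor_def)

lemma act_hom:
  assumes "\<gamma> \<in> carrier Cp"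
  shows "m_act M \<gamma> \<in> hom (m_und M) (m_und M)"
proof -
  have "restrict (m_act M \<gamma>) (carrier (m_und M)) \<in> hom (m_und M) (m_und M)"
    using hom_in_carrier[OF act_in_AutoGroup assms] by (simp add: AutoGroup_def auto_def)
  then show ?thesis
    by (auto simp: hom_def Pi_iff)
qed

lemma act_closed: "\<gamma> \<in> carrier Cp \<Longrightarrow> y \<in> carrier (m_und M) \<Longrightarrow> m_act M \<gamma> y \<in> carrier (m_und M)"
  using act_hom by (auto simp: hom_def)

lemma act_mult:
  assumes "\<gamma> \<in> carrier Cp" "\<delta> \<in> carrier Cp" "y \<in> carrier (m_und M)"
  shows "m_act M (\<gamma> \<otimes>\<^bsub>Cp\<^esub> \<delta>) y = m_act M \<gamma> (m_act M \<delta> y)"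
proof -
  let ?a = "\<lambda>\<gamma>. restrict (m_act M \<gamma>) (carrier (m_und M))"
  have B: "?a \<gamma> \<in> Bij (carrier (m_und M))" "?a \<delta> \<in> Bij (carrier (m_und M))"
    using hom_in_carrier[OF act_in_AutoGroup assms(1)] hom_in_carrier[OF act_in_AutoGroup assms(2)]
    by (simp_all add: AutoGroup_def auto_def)
  have "?a (\<gamma> \<otimes>\<^bsub>Cp\<^esub> \<delta>) = ?a \<gamma> \<otimes>\<^bsub>AutoGroup (m_und M)\<^esub> ?a \<delta>"
    by (rule hom_mult[OF act_in_AutoGroup assms(1,2)])
  also have "\<dots> = compose (carrier (m_und M)) (?a \<gamma>) (?a \<delta>)"
    using B by (simp add: AutoGroup_def BijGroup_def)
  finally have "?a (\<gamma> \<otimes>\<^bsub>Cp\<^esub> \<delta>) y = compose (carrier (m_und M)) (?a \<gamma>) (?a \<delta>) y"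
    by simp
  then show ?thesis
    using assms act_closed by (simp add: compose_def)
qed

lemma act_res: "\<gamma> \<in> carrier Cp \<Longrightarrow> x \<in> carrier (m_fix M) \<Longrightarrow> m_act M \<gamma> (m_res M x) = m_res M x"
  using mackey by (simp add: mackey_functor_def)

lemma res_tr:
  "y \<in> carrier (m_und M) \<Longrightarrow> m_res M (m_tr M y) = finprod (m_und M) (\<lambda>\<gamma>. m_act M \<gamma> y) (carrier Cp)"
  using mackey by (simp add: mackey_functor_def)

end

section \<open>The box product: action, generators, universal property\<close>

locale mackey_pair = M: cp_mackey p M + N: cp_mackey p N
  for p :: nat and M :: "('a, 'b) mackey" and N :: "('c, 'd) mackey"
begin

sublocale fixt: tensor_pair "m_fix M" "m_fix N"
  by unfold_locales

sublocale undt: tensor_pair "m_und M" "m_und N"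
  by unfold_locales

abbreviation U where "U \<equiv> tensor (m_und M) (m_und N)"
abbreviation F where "F \<equiv> tensor (m_fix M) (m_fix N)"
abbreviation act where "act \<equiv> box_act M N"
abbreviation Cv where "Cv \<equiv> coinvariants M.Cp U act"
abbreviation S where "S \<equiv> box_sum p M N"
abbreviation K where "K \<equiv> frobenius_rel p M N"
abbreviation norm where "norm \<equiv> box_norm p M N"
abbreviation box where "box \<equiv> mackey_box p M N"

lemma m_und_box [simp]: "m_und box = U"
  by (simp add: mackey_box_def box_und_def)

lemma m_act_box [simp]: "m_act box = act"
  by (simp add: mackey_box_def)

lemma m_fix_box: "m_fix box = S Mod K"
  by (simp add: mackey_box_def)

lemma group_hom_act:
  assumes "\<gamma> \<in> carrier M.Cp"
  shows "group_hom U U (act \<gamma>)"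
  unfolding box_act_def
  by (rule group_hom_tensor_map[OF undt.tensor_pair_axioms undt.tensor_pair_axioms M.act_hom N.act_hom])
    (use assms in auto)

lemma act_pure:
  assumes "\<gamma> \<in> carrier M.Cp" "x \<in> carrier (m_und M)" "y \<in> carrier (m_und N)"
  shows "act \<gamma> (undt.pure x y) = undt.pure (m_act M \<gamma> x) (m_act N \<gamma> y)"
  unfolding box_act_def
  by (rule tensor_map_pure[OF undt.tensor_pair_axioms undt.tensor_pair_axioms M.act_hom N.act_hom])
    (use assms in auto)

lemma act_closed: "\<gamma> \<in> carrier M.Cp \<Longrightarrow> z \<in> carrier U \<Longrightarrow> act \<gamma> z \<in> carrier U"
  using group_hom.hom_closed[OF group_hom_act] by blast

text \<open>Both sides are homomorphisms in \<open>z\<close>, so pure tensors suffice. The norm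
  absorbs a group element in \<open>norm_act\<close> by this identity.\<close>

lemma act_mult:
  assumes "\<gamma> \<in> carrier M.Cp" "\<delta> \<in> carrier M.Cp" "z \<in> carrier U"
  shows "act (\<gamma> \<otimes>\<^bsub>M.Cp\<^esub> \<delta>) z = act \<gamma> (act \<delta> z)"
proof -
  have c: "\<gamma> \<otimes>\<^bsub>M.Cp\<^esub> \<delta> \<in> carrier M.Cp"
    by (rule monoid.m_closed[OF group.is_monoid[OF group_integer_mod_group] assms(1,2)])
  have "act \<gamma> \<circ> act \<delta> \<in> hom U U"
    using assms group_hom_act by (meson group_hom.homh hom_compose)
  then have comp: "group_hom U U (act \<gamma> \<circ> act \<delta>)"
    by unfold_locales
  have "act (\<gamma> \<otimes>\<^bsub>M.Cp\<^esub> \<delta>) z = (act \<gamma> \<circ> act \<delta>) z"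
    using assms c
    by (intro undt.tensor_hom_eqI[OF group_hom_act[OF c] comp _ assms(3)])
      (auto simp: act_pure M.act_mult N.act_mult M.act_closed N.act_closed
        simp del: mult_integer_mod_group)
  then show ?thesis by simp
qed

sublocale cv: coinvariants_setting U M.Cp act
  by unfold_locales (auto simp: act_closed)

lemma S_eq: "S = F \<times>\<times> Cv"
  by (simp add: box_sum_def box_und_def)

sublocale S: comm_group S
  unfolding S_eq
  by (intro comm_group_DirProd fixt.tensor.comm_group_axioms cv.coinv.comm_group_axioms)

lemma box_sum_tr_eq: "box_sum_tr p M N z = (\<one>\<^bsub>F\<^esub>, coinv_cls M.Cp U act z)"
  by (simp add: box_sum_tr_def box_und_def)

lemma box_sum_pure_eq: "box_sum_pure p M N x y = (fixt.pure x y, \<one>\<^bsub>Cv\<^esub>)"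
  by (simp add: box_sum_pure_def box_und_def)

lemma group_hom_box_sum_tr: "group_hom U S (box_sum_tr p M N)"
  by (intro group_hom.intro group_hom_axioms.intro undt.tensor.group_axioms S.group_axioms homI)
    (auto simp: S_eq box_sum_tr_eq)

lemma bilinear_map_box_sum_pure: "bilinear_map (m_fix M) (m_fix N) S (box_sum_pure p M N)"
  using fixt.bilinear_map_pure
  by (auto simp: bilinear_map_def S_eq box_sum_pure_eq hom_def Pi_iff)

lemma box_sum_pure_closed [simp]:
  "x \<in> carrier (m_fix M) \<Longrightarrow> y \<in> carrier (m_fix N) \<Longrightarrow> box_sum_pure p M N x y \<in> carrier S"
  by (auto simp: S_eq box_sum_pure_eq)

lemma box_sum_tr_closed [simp]: "z \<in> carrier U \<Longrightarrow> box_sum_tr p M N z \<in> carrier S"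
  by (auto simp: S_eq box_sum_tr_eq)

lemma frobenius_gens_carrier:
  "{box_sum_pure p M N x (m_tr N y) \<otimes>\<^bsub>S\<^esub> inv\<^bsub>S\<^esub>
      box_sum_tr p M N (undt.pure (m_res M x) y) | x y.
      x \<in> carrier (m_fix M) \<and> y \<in> carrier (m_und N)} \<union>
   {box_sum_pure p M N (m_tr M x) y \<otimes>\<^bsub>S\<^esub> inv\<^bsub>S\<^esub>
      box_sum_tr p M N (undt.pure x (m_res N y)) | x y.
      x \<in> carrier (m_und M) \<and> y \<in> carrier (m_fix N)} \<subseteq> carrier S"
  by (intro Un_least subsetI; elim CollectE exE conjE; simp)

lemma subgroup_K: "subgroup K S"
  unfolding frobenius_rel_def using frobenius_gens_carrier by (rule S.generate_is_subgroup)

sublocale fb: comm_group "m_fix box"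
  unfolding m_fix_box using subgroup_K by (rule S.abelian_FactGroup)

sublocale q: group_hom S "m_fix box" "\<lambda>s. K #>\<^bsub>S\<^esub> s"
  using S.r_coset_hom_FactGroup[OF subgroup_K] by unfold_locales (simp add: m_fix_box)

definition bp :: "'a \<Rightarrow> 'c \<Rightarrow> ((('a \<times> 'c) \<Rightarrow>\<^sub>0 int) set \<times> (('b \<times> 'd) \<Rightarrow>\<^sub>0 int) set set) set" where
  "bp x y = K #>\<^bsub>S\<^esub> box_sum_pure p M N x y"

lemma m_tr_box: "m_tr box z = K #>\<^bsub>S\<^esub> box_sum_tr p M N z"
  by (simp add: mackey_box_def)

lemma bp_closed [simp]:
  "x \<in> carrier (m_fix M) \<Longrightarrow> y \<in> carrier (m_fix N) \<Longrightarrow> bp x y \<in> carrier (m_fix box)"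
  unfolding bp_def by simp

lemma bilinear_map_bp: "bilinear_map (m_fix M) (m_fix N) (m_fix box) bp"
  using bilinear_map_box_sum_pure
  by (auto simp: bilinear_map_def bp_def hom_def Pi_iff)

sublocale trb: group_hom U "m_fix box" "m_tr box"
proof -
  have "(\<lambda>s. K #>\<^bsub>S\<^esub> s) \<circ> box_sum_tr p M N \<in> hom U (m_fix box)"
    using group_hom_box_sum_tr q.homh by (meson group_hom.homh hom_compose)
  then show "group_hom U (m_fix box) (m_tr box)"
    by unfold_locales (simp add: m_tr_box[abs_def] o_def)
qed

lemma frobenius_left:
  assumes "x \<in> carrier (m_fix M)" "y \<in> carrier (m_und N)"
  shows "bp x (m_tr N y) = m_tr box (undt.pure (m_res M x) y)"
  unfolding bp_def m_tr_box
  by (rule S.r_coset_eqI[OF subgroup_K])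
    (use assms in \<open>auto simp: frobenius_rel_def intro!: generate.incl\<close>)

lemma frobenius_right:
  assumes "x \<in> carrier (m_und M)" "y \<in> carrier (m_fix N)"
  shows "bp (m_tr M x) y = m_tr box (undt.pure x (m_res N y))"
  unfolding bp_def m_tr_box
  by (rule S.r_coset_eqI[OF subgroup_K])
    (use assms in \<open>auto simp: frobenius_rel_def intro!: generate.incl\<close>)

text \<open>Elements of \<open>m_fix box\<close> are cosets in a sum of two quotients. With this
  rule, the later arguments on exponents, divisibility and coordinates never open these
  quotients.\<close>

lemma box_induct [consumes 1, case_names pure tr diff]:
  assumes "w \<in> carrier (m_fix box)"
    and pure: "\<And>x y. x \<in> carrier (m_fix M) \<Longrightarrow> y \<in> carrier (m_fix N) \<Longrightarrow> P (bp x y)"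
    and tr: "\<And>z. z \<in> carrier U \<Longrightarrow> P (m_tr box z)"
    and diff: "\<And>a b. a \<in> carrier (m_fix box) \<Longrightarrow> b \<in> carrier (m_fix box) \<Longrightarrow> P a \<Longrightarrow> P b \<Longrightarrow>
      P (a \<otimes>\<^bsub>m_fix box\<^esub> inv\<^bsub>m_fix box\<^esub> b)"
  shows "P w"
proof -
  obtain u z where u: "u \<in> carrier F" and z: "z \<in> carrier U"
    and w: "w = K #>\<^bsub>S\<^esub> (u, coinv_cls M.Cp U act z)"
    using assms(1) by (auto simp: m_fix_box carrier_FactGroup S_eq cv.carrier_coinvariants)
  have *: "P (K #>\<^bsub>S\<^esub> (u, \<one>\<^bsub>Cv\<^esub>))"
    using u
  proof (induction u rule: fixt.tensor_induct)
    case (pure x y)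
    then show ?case using assms(2) by (simp add: bp_def box_sum_pure_eq)
  next
    case (diff a b)
    have "(a \<otimes>\<^bsub>F\<^esub> inv\<^bsub>F\<^esub> b, \<one>\<^bsub>Cv\<^esub>) = (a, \<one>\<^bsub>Cv\<^esub>) \<otimes>\<^bsub>S\<^esub> inv\<^bsub>S\<^esub> (b, \<one>\<^bsub>Cv\<^esub>)"
      using diff
      by (simp add: S_eq inv_DirProd fixt.tensor.group_axioms cv.coinv.group_axioms)
    moreover have "(a, \<one>\<^bsub>Cv\<^esub>) \<in> carrier S" "(b, \<one>\<^bsub>Cv\<^esub>) \<in> carrier S"
      using diff by (auto simp: S_eq)
    ultimately show ?case
      using assms(4) diff by simp
  qed
  \<comment> \<open>A negative is zero minus the element, and zero is the transfer of zero.\<close>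
  have inv: "P (inv\<^bsub>m_fix box\<^esub> a)" if "a \<in> carrier (m_fix box)" "P a" for a
    using diff[OF _ that(1) _ that(2), of "m_tr box \<one>\<^bsub>U\<^esub>"] tr[of "\<one>\<^bsub>U\<^esub>"] that by simp
  have uS: "(u, \<one>\<^bsub>Cv\<^esub>) \<in> carrier S"
    using u by (auto simp: S_eq)
  have "(u, coinv_cls M.Cp U act z) = (u, \<one>\<^bsub>Cv\<^esub>) \<otimes>\<^bsub>S\<^esub> box_sum_tr p M N z"
    using u z by (simp add: S_eq box_sum_tr_eq)
  \<comment> \<open>The sum is written as the difference with a negative, since \<open>diff\<close>
    is the only closure rule.\<close>
  then have eq: "w = (K #>\<^bsub>S\<^esub> (u, \<one>\<^bsub>Cv\<^esub>)) \<otimes>\<^bsub>m_fix box\<^esub> inv\<^bsub>m_fix box\<^esub> (inv\<^bsub>m_fix box\<^esub> m_tr box z)"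
    unfolding w using uS z by (simp add: m_tr_box)
  show ?thesis
    unfolding eq using uS z by (intro diff inv tr *) auto
qed

lemma box_hom_eqI:
  assumes "group_hom (m_fix box) T h" "group_hom (m_fix box) T k"
    and "\<And>x y. x \<in> carrier (m_fix M) \<Longrightarrow> y \<in> carrier (m_fix N) \<Longrightarrow> h (bp x y) = k (bp x y)"
    and "\<And>z. z \<in> carrier U \<Longrightarrow> h (m_tr box z) = k (m_tr box z)"
    and "w \<in> carrier (m_fix box)"
  shows "h w = k w"
proof -
  interpret h: group_hom "m_fix box" T h by fact
  interpret k: group_hom "m_fix box" T k by fact
  show ?thesis
    using assms(5) by (induction w rule: box_induct) (auto simp: assms(3,4))
qed

lemma frobenius_rel_kernel:
  assumes "group_hom S T h"
    and "\<And>x y. x \<in> carrier (m_fix M) \<Longrightarrow> y \<in> carrier (m_und N) \<Longrightarrow>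
      h (box_sum_pure p M N x (m_tr N y)) = h (box_sum_tr p M N (undt.pure (m_res M x) y))"
    and "\<And>x y. x \<in> carrier (m_und M) \<Longrightarrow> y \<in> carrier (m_fix N) \<Longrightarrow>
      h (box_sum_pure p M N (m_tr M x) y) = h (box_sum_tr p M N (undt.pure x (m_res N y)))"
  shows "K \<subseteq> kernel S T h"
proof -
  interpret h: group_hom S T h by fact
  show ?thesis
    unfolding frobenius_rel_def
    by (rule generate_subset_kernel[OF assms(1) frobenius_gens_carrier]) (auto simp: assms(2,3))
qed

text \<open>Each hypothesis passes one layer of the quotient: bilinearity gives a map on the tensor
  product, invariance gives one on the coinvariants, and \<open>left\<close> and
  \<open>right\<close> make their sum kill the Frobenius relations.\<close>

lemma box_universal:
  assumes "comm_group T" "bilinear_map (m_fix M) (m_fix N) T B" "group_hom U T k"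
    and inv: "\<And>\<gamma> z. \<gamma> \<in> carrier M.Cp \<Longrightarrow> z \<in> carrier U \<Longrightarrow> k (act \<gamma> z) = k z"
    and left: "\<And>x y. x \<in> carrier (m_fix M) \<Longrightarrow> y \<in> carrier (m_und N) \<Longrightarrow>
      B x (m_tr N y) = k (undt.pure (m_res M x) y)"
    and right: "\<And>x y. x \<in> carrier (m_und M) \<Longrightarrow> y \<in> carrier (m_fix N) \<Longrightarrow>
      B (m_tr M x) y = k (undt.pure x (m_res N y))"
  obtains h where "group_hom (m_fix box) T h"
    "\<And>x y. x \<in> carrier (m_fix M) \<Longrightarrow> y \<in> carrier (m_fix N) \<Longrightarrow> h (bp x y) = B x y"
    "\<And>z. z \<in> carrier U \<Longrightarrow> h (m_tr box z) = k z"
proof -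
  interpret T: comm_group T by fact
  interpret k: group_hom U T k by fact
  obtain h0 where h0: "group_hom F T h0"
    "\<And>x y. x \<in> carrier (m_fix M) \<Longrightarrow> y \<in> carrier (m_fix N) \<Longrightarrow> h0 (fixt.pure x y) = B x y"
    using fixt.tensor_universal[OF assms(1,2)] by blast
  interpret h0: group_hom F T h0 by fact
  define h1 where "h1 c = the_elem (k ` c)" for c
  have h1: "group_hom Cv T h1" "\<And>z. z \<in> carrier U \<Longrightarrow> h1 (coinv_cls M.Cp U act z) = k z"
    unfolding h1_def[abs_def]
    using cv.group_hom_coinvariants_induced[OF assms(3) inv] cv.coinvariants_induced_cls[OF assms(3) inv]
    by auto
  interpret h1: group_hom Cv T h1 by fact
  define h where "h = (\<lambda>(u, v). h0 u \<otimes>\<^bsub>T\<^esub> h1 v)"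
  have h: "group_hom S T h"
    unfolding S_eq h_def by (rule hom_DirProd_mult[OF assms(1) h0(1) h1(1)])
  interpret h: group_hom S T h by fact
  have Bcl: "B x y \<in> carrier T" if "x \<in> carrier (m_fix M)" "y \<in> carrier (m_fix N)" for x y
    using that assms(2) by (auto simp: bilinear_map_def hom_def)
  have hp: "h (box_sum_pure p M N x y) = B x y" if "x \<in> carrier (m_fix M)" "y \<in> carrier (m_fix N)" for x y
    using that by (simp add: h_def box_sum_pure_eq h0(2) Bcl)
  have ht: "h (box_sum_tr p M N z) = k z" if "z \<in> carrier U" for z
    using that by (simp add: h_def box_sum_tr_eq h1(2))
  have ker: "K \<subseteq> kernel S T h"
    by (rule frobenius_rel_kernel[OF h]) (simp_all add: hp ht left right)
  obtain g where g: "g \<in> hom (S Mod K) T" "\<And>s. s \<in> carrier S \<Longrightarrow> g (K #>\<^bsub>S\<^esub> s) = h s"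
    using h.FactGroup_universal_kernel[OF _ ker] subgroup_K S.normal_iff_subgroup by blast
  show thesis
  proof (rule that[of g])
    show "group_hom (m_fix box) T g"
      by unfold_locales (use g(1) in \<open>simp add: m_fix_box\<close>)
  qed (simp_all add: bp_def m_tr_box g(2) hp ht)
qed

section \<open>Norm and restriction of the box product\<close>

lemma norm_eq: "norm z = finprod U (\<lambda>\<gamma>. act \<gamma> z) (carrier M.Cp)"
  by (simp add: box_norm_def box_und_def)

lemma act_Pi [simp]: "z \<in> carrier U \<Longrightarrow> (\<lambda>\<gamma>. act \<gamma> z) \<in> carrier M.Cp \<rightarrow> carrier U"
  by (simp add: act_closed)

lemma group_hom_norm: "group_hom U U norm"
proof -
  have "norm \<in> hom U U"
  proof (rule homI)
    fix y z assume yz: "y \<in> carrier U" "z \<in> carrier U"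
    have "norm (y \<otimes>\<^bsub>U\<^esub> z) = finprod U (\<lambda>\<gamma>. act \<gamma> y \<otimes>\<^bsub>U\<^esub> act \<gamma> z) (carrier M.Cp)"
      unfolding norm_eq
      by (rule undt.tensor.finprod_cong')
        (use yz in \<open>auto simp: act_closed group_hom.hom_mult[OF group_hom_act]\<close>)
    also have "\<dots> = norm y \<otimes>\<^bsub>U\<^esub> norm z"
      unfolding norm_eq using yz by (intro undt.tensor.finprod_multf) auto
    finally show "norm (y \<otimes>\<^bsub>U\<^esub> z) = norm y \<otimes>\<^bsub>U\<^esub> norm z" .
  qed (simp add: norm_eq act_closed)
  then show ?thesis by unfold_locales
qed

text \<open>Right translation by \<gamma> permutes C_p, so the sum over C_p does not change. Hence
  the norm descends to coinvariants.\<close>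

lemma norm_act:
  assumes "\<gamma> \<in> carrier M.Cp" "z \<in> carrier U"
  shows "norm (act \<gamma> z) = norm z"
proof -
  interpret C: comm_group M.Cp by simp
  have bij: "inj_on (\<lambda>\<delta>. \<delta> \<otimes>\<^bsub>M.Cp\<^esub> \<gamma>) (carrier M.Cp)"
    "(\<lambda>\<delta>. \<delta> \<otimes>\<^bsub>M.Cp\<^esub> \<gamma>) ` carrier M.Cp = carrier M.Cp"
    using C.inj_on_cmult[OF assms(1)] C.surj_const_mult[OF assms(1)] assms(1)
    by (simp_all add: add.commute)
  have "norm z = finprod U (\<lambda>\<delta>. act \<delta> z) ((\<lambda>\<delta>. \<delta> \<otimes>\<^bsub>M.Cp\<^esub> \<gamma>) ` carrier M.Cp)"
    by (simp only: bij norm_eq)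
  also have "\<dots> = finprod U (\<lambda>\<delta>. act (\<delta> \<otimes>\<^bsub>M.Cp\<^esub> \<gamma>) z) (carrier M.Cp)"
    by (rule undt.tensor.finprod_reindex) (use bij assms act_closed in auto)
  also have "\<dots> = norm (act \<gamma> z)"
    unfolding norm_eq
    by (rule undt.tensor.finprod_cong')
      (use assms in \<open>auto simp: act_mult act_closed simp del: mult_integer_mod_group\<close>)
  finally show ?thesis ..
qed

text \<open>The element \<open>m_res M x\<close> is fixed by C_p, so the action moves only
  \<open>y\<close>, and the sum becomes \<open>m_res N (m_tr N y)\<close>. With
  \<open>norm_pure_right\<close> this shows that the restriction respects Frobenius
  reciprocity.\<close>

lemma norm_pure_left:
  assumes "x \<in> carrier (m_fix M)" "y \<in> carrier (m_und N)"
  shows "norm (undt.pure (m_res M x) y) = undt.pure (m_res M x) (m_res N (m_tr N y))"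
proof -
  interpret l: group_hom "m_und N" U "undt.pure (m_res M x)"
    using assms by (intro undt.group_hom_pure_left) simp
  have "undt.pure (m_res M x) (m_res N (m_tr N y)) =
    finprod U (\<lambda>\<gamma>. undt.pure (m_res M x) (m_act N \<gamma> y)) (carrier M.Cp)"
    unfolding N.res_tr[OF assms(2)]
    by (rule N.ud.finprod_hom[OF undt.tensor.comm_group_axioms l.homh])
      (use assms in \<open>auto simp: N.act_closed\<close>)
  also have "\<dots> = norm (undt.pure (m_res M x) y)"
    unfolding norm_eq
    by (rule undt.tensor.finprod_cong') (use assms in \<open>auto simp: act_pure M.act_res act_closed\<close>)
  finally show ?thesis ..
qed

lemma norm_pure_right:
  assumes "x \<in> carrier (m_und M)" "y \<in> carrier (m_fix N)"
  shows "norm (undt.pure x (m_res N y)) = undt.pure (m_res M (m_tr M x)) (m_res N y)"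
proof -
  interpret l: group_hom "m_und M" U "\<lambda>x. undt.pure x (m_res N y)"
    using assms by (intro undt.group_hom_pure_right) simp
  have "undt.pure (m_res M (m_tr M x)) (m_res N y) =
    finprod U (\<lambda>\<gamma>. undt.pure (m_act M \<gamma> x) (m_res N y)) (carrier M.Cp)"
    unfolding M.res_tr[OF assms(1)]
    by (rule M.ud.finprod_hom[OF undt.tensor.comm_group_axioms l.homh])
      (use assms in \<open>auto simp: M.act_closed\<close>)
  also have "\<dots> = norm (undt.pure x (m_res N y))"
    unfolding norm_eq
    by (rule undt.tensor.finprod_cong') (use assms in \<open>auto simp: act_pure N.act_res act_closed\<close>)
  finally show ?thesis ..
qed

lemma m_res_box: "m_res box = (\<lambda>c. the_elem (box_sum_res p M N ` c))"
  by (simp add: mackey_box_def)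

lemma
  shows group_hom_m_res_box: "group_hom (m_fix box) U (m_res box)"
    and m_res_box_bp: "\<And>x y. x \<in> carrier (m_fix M) \<Longrightarrow> y \<in> carrier (m_fix N) \<Longrightarrow>
      m_res box (bp x y) = undt.pure (m_res M x) (m_res N y)"
    and m_res_box_tr: "\<And>z. z \<in> carrier U \<Longrightarrow> m_res box (m_tr box z) = norm z"
proof -
  let ?r = "box_sum_res p M N"
  let ?t = "tensor_map (m_fix M) (m_fix N) (m_und M) (m_und N) (m_res M) (m_res N)"
  interpret t: group_hom F U ?t
    by (rule group_hom_tensor_map[OF fixt.tensor_pair_axioms undt.tensor_pair_axioms M.res.homh N.res.homh])
  interpret n: group_hom Cv U "\<lambda>v. the_elem (norm ` v)"
    by (rule cv.group_hom_coinvariants_induced[OF group_hom_norm norm_act])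
  interpret nm: group_hom U U norm by (rule group_hom_norm)
  have hr: "group_hom S U ?r"
    using hom_DirProd_mult[OF undt.tensor.comm_group_axioms t.group_hom_axioms n.group_hom_axioms]
    by (simp add: S_eq box_sum_res_def box_und_def)
  have rp: "?r (box_sum_pure p M N x y) = undt.pure (m_res M x) (m_res N y)"
    if "x \<in> carrier (m_fix M)" "y \<in> carrier (m_fix N)" for x y
    using that tensor_map_pure[OF fixt.tensor_pair_axioms undt.tensor_pair_axioms M.res.homh N.res.homh]
      n.hom_one
    by (simp add: box_sum_res_def box_und_def box_sum_pure_eq del: n.hom_one)
  have rt: "?r (box_sum_tr p M N z) = norm z" if "z \<in> carrier U" for z
    using that t.hom_one cv.coinvariants_induced_cls[OF group_hom_norm norm_act that]
    by (simp add: box_sum_res_def box_und_def box_sum_tr_eq)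
  have ker: "K \<subseteq> kernel S U ?r"
    by (rule frobenius_rel_kernel[OF hr]) (simp_all add: rp rt norm_pure_left norm_pure_right)
  show "group_hom (m_fix box) U (m_res box)"
    unfolding m_res_box m_fix_box
    using the_elem_image_hom_FactGroup[OF S.comm_group_axioms hr subgroup_K ker] fb.group_axioms
    by (intro group_hom.intro group_hom_axioms.intro undt.tensor.group_axioms) (auto simp: m_fix_box)
  show "m_res box (bp x y) = undt.pure (m_res M x) (m_res N y)"
    if "x \<in> carrier (m_fix M)" "y \<in> carrier (m_fix N)" for x y
    unfolding m_res_box bp_def using that
    by (subst the_elem_image_r_coset[OF hr subgroup_K ker]) (auto simp: rp)
  show "m_res box (m_tr box z) = norm z" if "z \<in> carrier U" for z
    unfolding m_res_box m_tr_box using that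
    by (subst the_elem_image_r_coset[OF hr subgroup_K ker]) (auto simp: rt)
qed

end

section \<open>Pairings and infinite cyclic quotients\<close>

lemma surj_imageE:
  assumes "h ` A = UNIV"
  obtains x where "x \<in> A" "h x = y"
  using assms by (metis UNIV_I imageE)

lemma group_hom_int_pow_add:
  assumes "group_hom G integer_group h" "x \<in> carrier G"
  shows "h (x [^]\<^bsub>G\<^esub> (n :: int)) = n * h x"
  using group_hom.hom_int_pow[OF assms] by simp

lemma group_hom_mult_add:
  assumes "group_hom G integer_group h" "x \<in> carrier G" "y \<in> carrier G"
  shows "h (x \<otimes>\<^bsub>G\<^esub> y) = h x + h y"
  using group_hom.hom_mult[OF assms] by simp

lemma group_hom_inv_minus:
  assumes "group_hom G integer_group h" "x \<in> carrier G"
  shows "h (inv\<^bsub>G\<^esub> x) = - h x"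
  using group_hom.hom_inv[OF assms] by simp

text \<open>A nonzero subgroup of the integers is infinite cyclic, so a nonzero integer-valued
  homomorphism can be divided by a generator of its image.\<close>

lemma group_hom_int_normalise:
  assumes "group_hom G integer_group h" "x0 \<in> carrier G" "h x0 \<noteq> 0"
  obtains \<psi> where "group_hom G integer_group \<psi>" "\<psi> ` carrier G = UNIV"
    "\<And>x. x \<in> carrier G \<Longrightarrow> \<psi> x = 0 \<longleftrightarrow> h x = 0"
proof -
  interpret h: group_hom G integer_group h by fact
  define P where "P n \<longleftrightarrow> n > 0 \<and> (\<exists>x\<in>carrier G. h x = int n)" for n
  have "P (nat \<bar>h x0\<bar>)"
  proof (cases "h x0 > 0")
    case False
    then have "h (inv\<^bsub>G\<^esub> x0) = int (nat \<bar>h x0\<bar>)" "nat \<bar>h x0\<bar> > 0"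
      using assms by simp_all
    then show ?thesis
      unfolding P_def using h.G.inv_closed[OF assms(2)] by blast
  qed (use assms in \<open>auto simp: P_def\<close>)
  define m where "m = (LEAST n. P n)"
  have "P m"
    unfolding m_def using \<open>P (nat \<bar>h x0\<bar>)\<close> by (rule LeastI)
  then obtain x1 where m: "m > 0" and x1: "x1 \<in> carrier G" "h x1 = int m"
    by (auto simp: P_def)
  have dvd: "int m dvd h x" if "x \<in> carrier G" for x
  proof -
    \<comment> \<open>The remainder of \<open>h x\<close> modulo \<open>m\<close> is again a value
      of \<open>h\<close>, so a positive remainder would contradict the minimality of
      \<open>m\<close>.\<close>
    have "h (x \<otimes>\<^bsub>G\<^esub> x1 [^]\<^bsub>G\<^esub> (- (h x div int m))) = h x mod int m"
      using that x1 assms(1)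
      by (simp add: group_hom_mult_add[OF assms(1)] group_hom_int_pow_add minus_div_mult_eq_mod[symmetric])
    moreover have "\<not> P (nat (h x mod int m))"
      unfolding m_def using m
      by (intro not_less_Least) (simp add: m_def nat_less_iff)
    ultimately have "\<not> nat (h x mod int m) > 0"
      unfolding P_def using that x1(1) m
      by (metis h.G.int_pow_closed h.G.m_closed int_nat_eq of_nat_0_less_iff pos_mod_sign)
    then show ?thesis
      using m pos_mod_sign[of "int m" "h x"] unfolding dvd_eq_mod_eq_0 by linarith
  qed
  show thesis
  proof
    show "group_hom G integer_group (\<lambda>x. h x div int m)"
      by unfold_locales (auto simp: hom_def group_hom_mult_add[OF assms(1)] div_plus_div_distrib_dvd_left dvd)
    have "\<exists>x\<in>carrier G. n = h x div int m" for n
      using x1 m by (intro bexI[of _ "x1 [^]\<^bsub>G\<^esub> n"]) (simp_all add: group_hom_int_pow_add[OF assms(1)])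
    then show "(\<lambda>x. h x div int m) ` carrier G = UNIV"
      by (auto simp: image_def)
    show "(h x div int m = 0) = (h x = 0)" if "x \<in> carrier G" for x
      using dvd[OF that] m by (simp add: dvd_div_eq_0_iff)
  qed
qed

text \<open>The relation \<beta>(x', y) x = \<beta>(x, y) s, read modulo \<open>K\<close>, is
  \<open>swap\<close>. The assumption \<open>unimodular\<close> expresses, through multiples of
  \<open>x\<close>, that the values of \<open>b\<close> generate the integers. A single nonzero
  value then yields the coordinate \<psi>.\<close>

lemma (in comm_group) infinite_cyclic_quotient_of_pairing:
  fixes b :: "'a \<Rightarrow> 'q \<Rightarrow> int"
  assumes K: "subgroup K G"
    and hom: "\<And>y. y \<in> Q \<Longrightarrow> group_hom G integer_group (\<lambda>x. b x y)"
    and bK: "\<And>k y. k \<in> K \<Longrightarrow> y \<in> Q \<Longrightarrow> b k y = 0"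
    and swap: "\<And>x'. x' \<in> carrier G \<Longrightarrow> \<exists>s\<in>carrier G. \<forall>x\<in>carrier G. \<forall>y\<in>Q.
      x [^] b x' y \<otimes> inv (s [^] b x y) \<in> K"
    and unimodular: "\<And>x. x \<in> carrier G \<Longrightarrow> (\<And>x' y. x' \<in> carrier G \<Longrightarrow> y \<in> Q \<Longrightarrow> x [^] b x' y \<in> K) \<Longrightarrow> x \<in> K"
    and nonzero: "x0 \<in> carrier G" "y0 \<in> Q" "b x0 y0 \<noteq> 0"
  obtains \<psi> where "group_hom G integer_group \<psi>" "\<psi> ` carrier G = UNIV" "kernel G integer_group \<psi> = K"
proof -
  \<comment> \<open>When \<open>b x y = 0\<close>, the power of \<open>s\<close> drops out of
    \<open>swap\<close>.\<close>
  have nondeg: "x \<in> K" if x: "x \<in> carrier G" and 0: "\<And>y. y \<in> Q \<Longrightarrow> b x y = 0" for x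
  proof (rule unimodular[OF x])
    fix x' y assume x': "x' \<in> carrier G" and y: "y \<in> Q"
    obtain s where "s \<in> carrier G" "x [^] b x' y \<otimes> inv (s [^] b x y) \<in> K"
      using swap[OF x'] x y by blast
    then show "x [^] b x' y \<in> K"
      using x by (simp add: 0 y)
  qed
  \<comment> \<open>Each integer \<open>b x y\<close> is killed by \<open>n\<close>, hence zero, and
    \<open>nondeg\<close> applies.\<close>
  have torsion_free: "x \<in> K" if x: "x \<in> carrier G" and n: "x [^] n \<in> K" "n \<noteq> 0" for x and n :: int
  proof (rule nondeg[OF x])
    fix y assume y: "y \<in> Q"
    show "b x y = 0"
      using bK[OF n(1) y] n(2) group_hom_int_pow_add[OF hom[OF y] x, of n] by simp
  qed
  obtain s where s: "s \<in> carrier G"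
    "\<And>x. x \<in> carrier G \<Longrightarrow> x [^] b x0 y0 \<otimes> inv (s [^] b x y0) \<in> K"
    using swap[OF nonzero(1)] nonzero(2) by blast
  \<comment> \<open>Here the relation with \<open>s\<close> leaves a nonzero multiple of
    \<open>x\<close> in \<open>K\<close>.\<close>
  have inj: "x \<in> K" if "x \<in> carrier G" "b x y0 = 0" for x
    using torsion_free[OF that(1) _ nonzero(3)] s(2)[OF that(1)] that by simp
  obtain \<psi> where \<psi>: "group_hom G integer_group \<psi>" "\<psi> ` carrier G = UNIV"
    "\<And>x. x \<in> carrier G \<Longrightarrow> \<psi> x = 0 \<longleftrightarrow> b x y0 = 0"
    using group_hom_int_normalise[OF hom[OF nonzero(2)] nonzero(1) nonzero(3)] by metis
  have "kernel G integer_group \<psi> = K"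
    using inj bK[OF _ nonzero(2)] subgroup.mem_carrier[OF K] by (auto simp: kernel_def \<psi>(3))
  with \<psi> show thesis by (intro that)
qed

section \<open>Invertible Mackey functors are twisted Burnside functors\<close>

text \<open>Supplies the bilinear map (x, y) \<mapsto> \<beta>(x', y) x, with \<open>c\<close> in
  the role of \<beta>(x', -).\<close>

lemma (in comm_group) bilinear_map_int_pow:
  assumes "c \<in> hom H integer_group"
  shows "bilinear_map G H G (\<lambda>x y. x [^] c y)"
  using assms by (auto simp: bilinear_map_def hom_def int_pow_distrib int_pow_mult)

locale mackey_inverse = mackey_pair p M N
  for p :: nat and M :: "('a, 'b) mackey" and N :: "('c, 'd) mackey" +
  fixes f g
  assumes prime_p: "prime p"
    and fg: "(f, g) \<in> mackey_hom p (mackey_box p M N) (burnside p)"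
    and bij_f: "bij_betw f (carrier (m_fix (mackey_box p M N))) (carrier (m_fix (burnside p)))"
    and bij_g: "bij_betw g (carrier (m_und (mackey_box p M N))) (carrier (m_und (burnside p)))"
begin

sublocale g: group_hom U integer_group g
  using fg
  by (intro group_hom.intro group_hom_axioms.intro undt.tensor.group_axioms group_integer_group)
    (simp add: mackey_hom_def burnside_def twisted_burnside_def)

sublocale f: group_hom "m_fix box" "integer_group \<times>\<times> integer_group" f
  using fg DirProd_group[OF group_integer_group group_integer_group]
  by (intro group_hom.intro group_hom_axioms.intro fb.group_axioms)
    (auto simp add: mackey_hom_def burnside_def twisted_burnside_def)

lemma f_tr: "z \<in> carrier U \<Longrightarrow> f (m_tr box z) = (0, g z)"
  using fg by (simp add: mackey_hom_def burnside_def twisted_burnside_def)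

lemma g_res: "w \<in> carrier (m_fix box) \<Longrightarrow> g (m_res box w) = fst (f w) + snd (f w) * int p"
  using fg by (auto simp add: mackey_hom_def burnside_def twisted_burnside_def split_beta)

lemma group_hom_fst_f: "group_hom (m_fix box) integer_group (\<lambda>w. fst (f w))"
proof -
  have "(\<lambda>w. fst (f w)) \<in> hom (m_fix box) integer_group"
    by (rule homI) (auto simp: mult_DirProd')
  then show ?thesis by unfold_locales
qed

text \<open>Preimages of the generator of the underlying group of the Burnside functor and of its
  element 1. Induced maps are evaluated at these points to produce s.\<close>

definition z1 where "z1 = the_inv_into (carrier U) g 1"
definition w1 where "w1 = the_inv_into (carrier (m_fix box)) f (1, 0)"

lemma inj_g: "inj_on g (carrier U)" and surj_g: "g ` carrier U = UNIV"
  using bij_g by (auto simp: bij_betw_def burnside_def twisted_burnside_def)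

lemma inj_f: "inj_on f (carrier (m_fix box))" and surj_f: "f ` carrier (m_fix box) = UNIV"
  using bij_f by (auto simp: bij_betw_def burnside_def twisted_burnside_def)

lemma z1 [simp]: "z1 \<in> carrier U" "g z1 = 1"
  unfolding z1_def using the_inv_into_into[OF inj_g, of 1] f_the_inv_into_f[OF inj_g, of 1] surj_g by auto

lemma w1 [simp]: "w1 \<in> carrier (m_fix box)" "f w1 = (1, 0)"
  unfolding w1_def
  using the_inv_into_into[OF inj_f, of "(1, 0)"] f_the_inv_into_f[OF inj_f, of "(1, 0)"] surj_f by auto

text \<open>Through \<open>g\<close>, the element \<open>z1\<close> generates \<open>U\<close>, so a
  homomorphism is known from its value there; that value serves as s.\<close>

lemma und_hom_eq:
  assumes "group_hom U T h" "z \<in> carrier U"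
  shows "h z = h z1 [^]\<^bsub>T\<^esub> g z"
proof -
  have "z = z1 [^]\<^bsub>U\<^esub> g z"
    by (rule inj_onD[OF inj_g]) (use assms(2) in \<open>simp_all add: group_hom_int_pow_add[OF g.group_hom_axioms]\<close>)
  then show ?thesis
    using group_hom.hom_int_pow[OF assms(1) z1(1)] by metis
qed

text \<open>Modulo transfers, \<open>w1\<close> generates: after the multiple of \<open>w1\<close>
  with the right first coordinate is subtracted, \<open>f\<close> sends the rest of \<open>w\<close>
  to a multiple of [C_p], and such an element is a transfer because \<open>g\<close> is onto and
  \<open>f\<close> injective.\<close>

lemma fix_hom_eq:
  assumes "group_hom (m_fix box) T h" "\<And>z. z \<in> carrier U \<Longrightarrow> h (m_tr box z) = \<one>\<^bsub>T\<^esub>"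
    and "w \<in> carrier (m_fix box)"
  shows "h w = h w1 [^]\<^bsub>T\<^esub> fst (f w)"
proof -
  interpret h: group_hom "m_fix box" T h by fact
  let ?v = "w1 [^]\<^bsub>m_fix box\<^esub> fst (f w)"
  obtain z where z: "z \<in> carrier U" "g z = snd (f (w \<otimes>\<^bsub>m_fix box\<^esub> inv\<^bsub>m_fix box\<^esub> ?v))"
    using surj_g by (rule surj_imageE)
  have v: "?v \<in> carrier (m_fix box)" by simp
  have "fst (f ?v) = fst (f w)"
    using group_hom_int_pow_add[OF group_hom_fst_f w1(1)] by simp
  then have "fst (f (w \<otimes>\<^bsub>m_fix box\<^esub> inv\<^bsub>m_fix box\<^esub> ?v)) = 0"
    using assms(3) v
    by (simp only: group_hom_mult_add[OF group_hom_fst_f] group_hom_inv_minus[OF group_hom_fst_f] fb.inv_closed)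
  then have "w \<otimes>\<^bsub>m_fix box\<^esub> inv\<^bsub>m_fix box\<^esub> ?v = m_tr box z"
    by (intro inj_onD[OF inj_f]) (use assms(3) z in \<open>simp_all add: f_tr prod_eq_iff\<close>)
  then have "h (w \<otimes>\<^bsub>m_fix box\<^esub> inv\<^bsub>m_fix box\<^esub> ?v) = \<one>\<^bsub>T\<^esub>"
    using assms(2) z by simp
  then have "h w \<otimes>\<^bsub>T\<^esub> inv\<^bsub>T\<^esub> h ?v = \<one>\<^bsub>T\<^esub>"
    using assms(3) by simp
  then have "h w = h ?v"
    using h.H.inv_solve_right[of "\<one>\<^bsub>T\<^esub>" "h w" "h ?v"] assms(3) v by simp
  then show ?thesis
    using h.hom_int_pow[OF w1(1)] by simp
qed

lemma und_M_infinite_cyclic: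
  obtains \<psi> where "group_hom (m_und M) integer_group \<psi>" "bij_betw \<psi> (carrier (m_und M)) UNIV"
proof -
  define b where "b x y = g (undt.pure x y)" for x y
  have b_hom: "group_hom (m_und M) integer_group (\<lambda>x. b x y)" if "y \<in> carrier (m_und N)" for y
    using that undt.bilinear_map_pure g.homh unfolding b_def
    by unfold_locales (auto simp: bilinear_map_def hom_def Pi_iff)
  have b_hom': "b x \<in> hom (m_und N) integer_group" if "x \<in> carrier (m_und M)" for x
    using that undt.bilinear_map_pure g.homh unfolding b_def
    by (auto simp: bilinear_map_def hom_def Pi_iff)
  have swap: "\<exists>s\<in>carrier (m_und M). \<forall>x\<in>carrier (m_und M). \<forall>y\<in>carrier (m_und N).
      x [^]\<^bsub>m_und M\<^esub> b x' y \<otimes>\<^bsub>m_und M\<^esub> inv\<^bsub>m_und M\<^esub> (s [^]\<^bsub>m_und M\<^esub> b x y) \<in> {\<one>\<^bsub>m_und M\<^esub>}"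
    if x': "x' \<in> carrier (m_und M)" for x'
  proof -
    have "bilinear_map (m_und M) (m_und N) (m_und M) (\<lambda>x y. x [^]\<^bsub>m_und M\<^esub> b x' y)"
      by (rule M.ud.bilinear_map_int_pow[OF b_hom'[OF x']])
    then obtain h where h: "group_hom U (m_und M) h"
      "\<And>x y. x \<in> carrier (m_und M) \<Longrightarrow> y \<in> carrier (m_und N) \<Longrightarrow> h (undt.pure x y) = x [^]\<^bsub>m_und M\<^esub> b x' y"
      using undt.tensor_universal[OF M.ud.comm_group_axioms] by blast
    have "h z1 \<in> carrier (m_und M)"
      using h(1) z1(1) by (rule group_hom.hom_closed)
    moreover have "x [^]\<^bsub>m_und M\<^esub> b x' y = h z1 [^]\<^bsub>m_und M\<^esub> b x y"
      if "x \<in> carrier (m_und M)" "y \<in> carrier (m_und N)" for x y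
      using und_hom_eq[OF h(1), of "undt.pure x y"] h(2) that by (simp add: b_def)
    ultimately show ?thesis by (intro bexI[of _ "h z1"]) auto
  qed
  have unimodular: "x \<in> {\<one>\<^bsub>m_und M\<^esub>}" if x: "x \<in> carrier (m_und M)"
    and 1: "\<And>x' y. x' \<in> carrier (m_und M) \<Longrightarrow> y \<in> carrier (m_und N) \<Longrightarrow> x [^]\<^bsub>m_und M\<^esub> b x' y \<in> {\<one>\<^bsub>m_und M\<^esub>}" for x
  proof -
    \<comment> \<open>The exponents annihilating \<open>x\<close> form a subgroup of the integers.
      It contains \<open>g\<close> of every pure tensor, hence the whole image of \<open>g\<close>,
      hence 1.\<close>
    have "x [^]\<^bsub>m_und M\<^esub> g z = \<one>\<^bsub>m_und M\<^esub>" if "z \<in> carrier U" for z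
      using that
    proof (induction z rule: undt.tensor_induct)
      case (diff a b)
      then show ?case using x by (simp add: M.ud.int_pow_diff)
    qed (use 1 in \<open>auto simp: b_def\<close>)
    from this[OF z1(1)] show ?thesis using x by simp
  qed
  obtain x0 y0 where 0: "x0 \<in> carrier (m_und M)" "y0 \<in> carrier (m_und N)" "b x0 y0 \<noteq> 0"
  proof (rule ccontr)
    assume *: "\<not> thesis"
    note witness = that
    \<comment> \<open>Were all values of \<open>b\<close> zero, \<open>g\<close> would vanish on
      pure tensors and so everywhere, against \<open>g z1 = 1\<close>.\<close>
    have "g z = 0" if "z \<in> carrier U" for z
      using that
    proof (induction z rule: undt.tensor_induct)
      case (pure x y)
      then show ?case using * witness by (auto simp: b_def)
    qed auto
    from this[OF z1(1)] show False by simp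
  qed
  obtain \<psi> where \<psi>: "group_hom (m_und M) integer_group \<psi>" "\<psi> ` carrier (m_und M) = UNIV"
    "kernel (m_und M) integer_group \<psi> = {\<one>\<^bsub>m_und M\<^esub>}"
    by (rule M.ud.infinite_cyclic_quotient_of_pairing[OF M.ud.triv_subgroup b_hom _ swap unimodular 0])
      (use b_hom group_hom.hom_one in fastforce)+
  then show thesis
    using that group_hom.inj_iff_trivial_ker[OF \<psi>(1)] by (auto simp: bij_betw_def)
qed

text \<open>Parallel to \<open>und_M_infinite_cyclic\<close>, with \<open>box_universal\<close> in
  place of \<open>tensor_universal\<close>. The auxiliary map takes values modulo transfers, where
  it can be trivial on the transfers of the box product and still satisfy Frobenius
  reciprocity.\<close>

lemma fix_M_mod_transfer_infinite_cyclic: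
  obtains \<chi> where "group_hom (m_fix M) integer_group \<chi>" "\<chi> ` carrier (m_fix M) = UNIV"
    "kernel (m_fix M) integer_group \<chi> = m_tr M ` carrier (m_und M)"
proof -
  define L where "L = m_tr M ` carrier (m_und M)"
  have L: "subgroup L (m_fix M)"
    unfolding L_def by (rule M.tr.img_is_subgroup)
  have L_cls: "L #>\<^bsub>m_fix M\<^esub> x = L" if "x \<in> L" for x
    using M.fx.coset_join2[OF _ L that] subgroup.mem_carrier[OF L that] by simp
  define b where "b x y = fst (f (bp x y))" for x y
  have b_hom: "group_hom (m_fix M) integer_group (\<lambda>x. b x y)" if "y \<in> carrier (m_fix N)" for y
    using that bilinear_map_bp group_hom.homh[OF group_hom_fst_f] unfolding b_def
    by unfold_locales (auto simp: bilinear_map_def hom_def Pi_iff)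
  have b_hom': "b x \<in> hom (m_fix N) integer_group" if "x \<in> carrier (m_fix M)" for x
    using that bilinear_map_bp group_hom.homh[OF group_hom_fst_f] unfolding b_def
    by (auto simp: bilinear_map_def hom_def Pi_iff)
  have bL: "b k y = 0" if "k \<in> L" "y \<in> carrier (m_fix N)" for k y
    using that by (auto simp: L_def b_def frobenius_right f_tr)
  have bL': "b x (m_tr N y) = 0" if "x \<in> carrier (m_fix M)" "y \<in> carrier (m_und N)" for x y
    using that by (auto simp: b_def frobenius_left f_tr)
  interpret Q: comm_group "m_fix M Mod L"
    using L by (rule M.fx.abelian_FactGroup)
  have cl: "(\<lambda>x. L #>\<^bsub>m_fix M\<^esub> x) \<in> hom (m_fix M) (m_fix M Mod L)"
    by (rule M.fx.r_coset_hom_FactGroup[OF L])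
  have swap: "\<exists>s\<in>carrier (m_fix M). \<forall>x\<in>carrier (m_fix M). \<forall>y\<in>carrier (m_fix N).
      x [^]\<^bsub>m_fix M\<^esub> b x' y \<otimes>\<^bsub>m_fix M\<^esub> inv\<^bsub>m_fix M\<^esub> (s [^]\<^bsub>m_fix M\<^esub> b x y) \<in> L"
    if x': "x' \<in> carrier (m_fix M)" for x'
  proof -
    let ?B = "\<lambda>x y. L #>\<^bsub>m_fix M\<^esub> (x [^]\<^bsub>m_fix M\<^esub> b x' y)"
    have "bilinear_map (m_fix M) (m_fix N) (m_fix M) (\<lambda>x y. x [^]\<^bsub>m_fix M\<^esub> b x' y)"
      by (rule M.fx.bilinear_map_int_pow[OF b_hom'[OF x']])
    then have B: "bilinear_map (m_fix M) (m_fix N) (m_fix M Mod L) ?B"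
      using cl by (auto simp: bilinear_map_def hom_def Pi_iff)
    \<comment> \<open>Transfers go to the trivial class. The Frobenius conditions hold because
      \<open>b x'\<close> vanishes on transfers of \<open>N\<close> and powers of transfers of
      \<open>M\<close> lie in \<open>L\<close>.\<close>
    have one: "group_hom U (m_fix M Mod L) (\<lambda>_. \<one>\<^bsub>m_fix M Mod L\<^esub>)"
      by unfold_locales (auto simp: hom_def simp del: one_FactGroup mult_FactGroup)
    have left: "?B x (m_tr N y) = \<one>\<^bsub>m_fix M Mod L\<^esub>"
      if "x \<in> carrier (m_fix M)" "y \<in> carrier (m_und N)" for x y
      using that x' bL' L_cls subgroup.one_closed[OF L] by simp
    have right: "?B (m_tr M x) y = \<one>\<^bsub>m_fix M Mod L\<^esub>"
      if "x \<in> carrier (m_und M)" "y \<in> carrier (m_fix N)" for x y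
      using that L_cls M.fx.subgroup_int_pow_closed[OF L, of "m_tr M x"] by (simp add: L_def)
    have "\<exists>h. group_hom (m_fix box) (m_fix M Mod L) h \<and>
      (\<forall>x\<in>carrier (m_fix M). \<forall>y\<in>carrier (m_fix N). h (bp x y) = ?B x y) \<and>
      (\<forall>z\<in>carrier U. h (m_tr box z) = \<one>\<^bsub>m_fix M Mod L\<^esub>)"
      by (rule box_universal[OF Q.comm_group_axioms B one refl left right]) blast+
    then obtain h where h: "group_hom (m_fix box) (m_fix M Mod L) h"
      "\<And>x y. x \<in> carrier (m_fix M) \<Longrightarrow> y \<in> carrier (m_fix N) \<Longrightarrow>
        h (bp x y) = ?B x y"
      "\<And>z. z \<in> carrier U \<Longrightarrow> h (m_tr box z) = \<one>\<^bsub>m_fix M Mod L\<^esub>"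
      by blast
    \<comment> \<open>The pairing lemma asks for an element of \<open>m_fix M\<close>, so a
      representative of the coset \<open>h w1\<close> is chosen.\<close>
    obtain s where s: "s \<in> carrier (m_fix M)" "h w1 = L #>\<^bsub>m_fix M\<^esub> s"
      using group_hom.hom_closed[OF h(1) w1(1)] by (auto simp: carrier_FactGroup)
    have "x [^]\<^bsub>m_fix M\<^esub> b x' y \<otimes>\<^bsub>m_fix M\<^esub> inv\<^bsub>m_fix M\<^esub> (s [^]\<^bsub>m_fix M\<^esub> b x y) \<in> L"
      if xy: "x \<in> carrier (m_fix M)" "y \<in> carrier (m_fix N)" for x y
    proof -
      have "L #>\<^bsub>m_fix M\<^esub> (x [^]\<^bsub>m_fix M\<^esub> b x' y) = L #>\<^bsub>m_fix M\<^esub> (s [^]\<^bsub>m_fix M\<^esub> b x y)"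
        using fix_hom_eq[OF h(1,3), of "bp x y"] h(2) xy s
        by (simp add: b_def M.fx.r_coset_int_pow_FactGroup[OF L])
      then have "x [^]\<^bsub>m_fix M\<^esub> b x' y \<in> L #>\<^bsub>m_fix M\<^esub> (s [^]\<^bsub>m_fix M\<^esub> b x y)"
        using M.fx.rcos_self[OF _ L, of "x [^]\<^bsub>m_fix M\<^esub> b x' y"] xy by simp
      then show ?thesis
        using subgroup.rcos_module_imp[OF L M.fx.group_axioms] s(1) by blast
    qed
    then show ?thesis using s(1) by blast
  qed
  have unimodular: "x \<in> L" if x: "x \<in> carrier (m_fix M)"
    and 1: "\<And>x' y. x' \<in> carrier (m_fix M) \<Longrightarrow> y \<in> carrier (m_fix N) \<Longrightarrow> x [^]\<^bsub>m_fix M\<^esub> b x' y \<in> L" for x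
  proof -
    have "x [^]\<^bsub>m_fix M\<^esub> fst (f w) \<in> L" if "w \<in> carrier (m_fix box)" for w
      using that
    proof (induction w rule: box_induct)
      case (diff a b)
      then have "fst (f (a \<otimes>\<^bsub>m_fix box\<^esub> inv\<^bsub>m_fix box\<^esub> b)) = fst (f a) - fst (f b)"
        by (simp only: group_hom_mult_add[OF group_hom_fst_f] group_hom_inv_minus[OF group_hom_fst_f] fb.inv_closed)
      then show ?case
        using x diff L by (simp add: M.fx.int_pow_diff subgroup.m_closed subgroup.m_inv_closed del: f.hom_mult f.hom_inv)
    qed (use 1 subgroup.one_closed[OF L] in \<open>auto simp: b_def f_tr\<close>)
    from this[OF w1(1)] show ?thesis using x by simp
  qed
  obtain x0 y0 where 0: "x0 \<in> carrier (m_fix M)" "y0 \<in> carrier (m_fix N)" "b x0 y0 \<noteq> 0"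
  proof (rule ccontr)
    assume *: "\<not> thesis"
    note witness = that
    have "fst (f w) = 0" if "w \<in> carrier (m_fix box)" for w
      using that
    proof (induction w rule: box_induct)
      case (pure x y)
      then show ?case using * witness by (auto simp: b_def)
    next
      case (diff a b)
      then have "fst (f (a \<otimes>\<^bsub>m_fix box\<^esub> inv\<^bsub>m_fix box\<^esub> b)) = fst (f a) - fst (f b)"
        by (simp only: group_hom_mult_add[OF group_hom_fst_f] group_hom_inv_minus[OF group_hom_fst_f] fb.inv_closed)
      then show ?case using diff by simp
    qed (auto simp: f_tr)
    from this[OF w1(1)] show False by simp
  qed
  show thesis
    by (rule M.fx.infinite_cyclic_quotient_of_pairing[OF L b_hom bL swap unimodular 0])
      (use that in \<open>auto simp: L_def\<close>)
qed

lemma M_isomorphic_twisted_burnside: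
  "\<exists>d. gcd d (int p) = 1 \<and> mackey_isomorphic p M (twisted_burnside p d)"
proof -
  obtain \<psi> where \<psi>: "group_hom (m_und M) integer_group \<psi>" "bij_betw \<psi> (carrier (m_und M)) UNIV"
    by (rule und_M_infinite_cyclic)
  obtain \<chi> where \<chi>: "group_hom (m_fix M) integer_group \<chi>" "\<chi> ` carrier (m_fix M) = UNIV"
    and ker: "kernel (m_fix M) integer_group \<chi> = m_tr M ` carrier (m_und M)"
    by (rule fix_M_mod_transfer_infinite_cyclic)
  interpret \<psi>: group_hom "m_und M" integer_group \<psi> by fact
  interpret \<chi>: group_hom "m_fix M" integer_group \<chi> by fact
  note \<psi>_pow = group_hom_int_pow_add[OF \<psi>(1)]
  have inj: "inj_on \<psi> (carrier (m_und M))" and surj: "\<psi> ` carrier (m_und M) = UNIV"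
    using \<psi>(2) by (auto simp: bij_betw_def)
  obtain t where t: "t \<in> carrier (m_und M)" "\<psi> t = 1"
    using surj by (rule surj_imageE)
  obtain v where v: "v \<in> carrier (m_fix M)" "\<chi> v = 1"
    using \<chi>(2) by (rule surj_imageE)
  have gen: "y = t [^]\<^bsub>m_und M\<^esub> \<psi> y" if "y \<in> carrier (m_und M)" for y
    by (rule inj_onD[OF inj]) (use that t in \<open>simp_all add: \<psi>_pow\<close>)
  have p1: "int p > 1"
    using prime_gt_1_nat[OF prime_p] by simp

  \<comment> \<open>If p divided every restriction in \<open>M\<close>, it would divide every
    restriction in the box product, measured by \<open>g\<close>; but \<open>w1\<close> restricts to
    1.\<close>
  obtain x0 where x0: "x0 \<in> carrier (m_fix M)" "\<not> int p dvd \<psi> (m_res M x0)"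
  proof (rule ccontr)
    assume *: "\<not> thesis"
    note witness = that
    interpret rb: group_hom "m_fix box" U "m_res box" by (rule group_hom_m_res_box)
    have "int p dvd g (m_res box w)" if "w \<in> carrier (m_fix box)" for w
      using that
    proof (induction w rule: box_induct)
      case (pure x y)
      then have "int p dvd \<psi> (m_res M x)" using * witness by auto
      moreover interpret r: group_hom "m_und M" U "\<lambda>x. undt.pure x (m_res N y)"
        using pure by (intro undt.group_hom_pure_right) simp
      \<comment> \<open>As \<open>m_res M x\<close> is a multiple of \<open>t\<close>, its
        \<psi>-coordinate factors out of the pure tensor.\<close>
      have "g (undt.pure (m_res M x) (m_res N y)) = \<psi> (m_res M x) * g (undt.pure t (m_res N y))"
        using arg_cong[OF gen[OF M.res.hom_closed[OF pure(1)]], of "\<lambda>x. g (undt.pure x (m_res N y))"]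
          r.hom_int_pow[OF t(1)] pure t
        by (simp add: group_hom_int_pow_add[OF g.group_hom_axioms])
      ultimately show ?case
        using pure by (simp add: m_res_box_bp)
    next
      case (tr z)
      then show ?case by (simp add: g_res f_tr)
    next
      case (diff a b)
      then show ?case by simp
    qed
    from this[OF w1(1)] show False using p1 by (simp add: g_res)
  qed

  \<comment> \<open>An endomorphism of an infinite cyclic group multiplies by a constant
    \<open>c\<close>. The nonzero element \<open>m_res M x0\<close> is fixed, so
    \<open>c = 1\<close>.\<close>
  have act: "m_act M \<gamma> y = y" if \<gamma>: "\<gamma> \<in> carrier M.Cp" and y: "y \<in> carrier (m_und M)" for \<gamma> y
  proof -
    interpret a: group_hom "m_und M" "m_und M" "m_act M \<gamma>"
      using M.act_hom[OF \<gamma>] by unfold_locales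
    define c where "c = \<psi> (m_act M \<gamma> t)"
    have c: "\<psi> (m_act M \<gamma> y) = \<psi> y * c" if "y \<in> carrier (m_und M)" for y
      using gen[OF that] a.hom_int_pow[OF t(1)] t(1) \<psi>_pow unfolding c_def by (metis a.hom_closed)
    have "\<psi> (m_res M x0) = \<psi> (m_res M x0) * c"
      using c[of "m_res M x0"] x0(1) M.act_res[OF \<gamma>] by simp
    moreover have "\<psi> (m_res M x0) \<noteq> 0"
      using x0(2) by auto
    ultimately have "c = 1" by simp
    then show ?thesis
      using c[OF y] y by (intro inj_onD[OF inj]) (auto simp: M.act_closed \<gamma>)
  qed
  have res_tr: "\<psi> (m_res M (m_tr M y)) = int p * \<psi> y" if y: "y \<in> carrier (m_und M)" for y
  proof -
    have "m_res M (m_tr M y) = finprod (m_und M) (\<lambda>_. y) (carrier M.Cp)"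
      unfolding M.res_tr[OF y] by (rule M.ud.finprod_cong') (use act y in auto)
    also have "\<dots> = y [^]\<^bsub>m_und M\<^esub> int p"
      using M.ud.finprod_const[OF y, of "carrier M.Cp"] by (simp add: int_pow_int)
    finally show ?thesis using y by (simp add: \<psi>_pow)
  qed

  \<comment> \<open>The twist is the restriction of the lift \<open>v\<close>. The coefficient
    \<beta> of [C_p] is read off from the restriction, because a transfer restricts to p times its
    coordinate; \<open>decomp\<close> shows that the division is exact. In particular the transfer
    is injective.\<close>
  define d where "d = \<psi> (m_res M v)"
  define \<beta> where "\<beta> x = (\<psi> (m_res M x) - \<chi> x * d) div int p" for x
  have decomp: "\<exists>y\<in>carrier (m_und M). x = v [^]\<^bsub>m_fix M\<^esub> \<chi> x \<otimes>\<^bsub>m_fix M\<^esub> m_tr M y \<and>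
      \<psi> (m_res M x) = \<chi> x * d + int p * \<psi> y" if x: "x \<in> carrier (m_fix M)" for x
  proof -
    let ?x = "inv\<^bsub>m_fix M\<^esub> (v [^]\<^bsub>m_fix M\<^esub> \<chi> x) \<otimes>\<^bsub>m_fix M\<^esub> x"
    have "?x \<in> kernel (m_fix M) integer_group \<chi>"
      using x v by (simp add: kernel_def group_hom_int_pow_add[OF \<chi>(1)])
    then obtain y where y: "y \<in> carrier (m_und M)" "?x = m_tr M y"
      unfolding ker by auto
    have *: "x = v [^]\<^bsub>m_fix M\<^esub> \<chi> x \<otimes>\<^bsub>m_fix M\<^esub> m_tr M y"
      using x v y by (metis M.fx.int_pow_closed M.fx.inv_solve_left M.tr.hom_closed)
    have "\<psi> (m_res M x) = \<psi> (m_res M (v [^]\<^bsub>m_fix M\<^esub> \<chi> x \<otimes>\<^bsub>m_fix M\<^esub> m_tr M y))"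
      using * by simp
    also have "\<dots> = \<chi> x * d + int p * \<psi> y"
      using v y by (simp add: M.res.hom_int_pow \<psi>_pow d_def res_tr)
    finally show ?thesis using * y by blast
  qed
  have \<beta>: "\<psi> (m_res M x) = \<chi> x * d + int p * \<beta> x" if "x \<in> carrier (m_fix M)" for x
    using decomp[OF that] p1 by (auto simp: \<beta>_def)
  have \<beta>_tr: "\<beta> (m_tr M y) = \<psi> y" and \<chi>_tr: "\<chi> (m_tr M y) = 0" if "y \<in> carrier (m_und M)" for y
  proof -
    have "m_tr M y \<in> kernel (m_fix M) integer_group \<chi>"
      using that ker by auto
    then show "\<chi> (m_tr M y) = 0" by (simp add: kernel_def)
    then show "\<beta> (m_tr M y) = \<psi> y"
      using \<beta>[of "m_tr M y"] that res_tr[OF that] p1 by simp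
  qed
  have \<beta>_mult: "\<beta> (x \<otimes>\<^bsub>m_fix M\<^esub> x') = \<beta> x + \<beta> x'"
    if "x \<in> carrier (m_fix M)" "x' \<in> carrier (m_fix M)" for x x'
  proof -
    have "int p * \<beta> (x \<otimes>\<^bsub>m_fix M\<^esub> x') = int p * (\<beta> x + \<beta> x')"
      using \<beta>[OF that(1)] \<beta>[OF that(2)] \<beta>[of "x \<otimes>\<^bsub>m_fix M\<^esub> x'"] that by (simp add: algebra_simps)
    then show ?thesis using p1 by simp
  qed
  have eq_tr: "x = v [^]\<^bsub>m_fix M\<^esub> \<chi> x \<otimes>\<^bsub>m_fix M\<^esub> m_tr M (t [^]\<^bsub>m_und M\<^esub> \<beta> x)" if "x \<in> carrier (m_fix M)" for x
  proof -
    obtain y where y: "y \<in> carrier (m_und M)" "x = v [^]\<^bsub>m_fix M\<^esub> \<chi> x \<otimes>\<^bsub>m_fix M\<^esub> m_tr M y"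
      "\<psi> (m_res M x) = \<chi> x * d + int p * \<psi> y"
      using decomp[OF \<open>x \<in> carrier (m_fix M)\<close>] by blast
    then have "\<psi> y = \<beta> x" using \<beta>[OF that] p1 by simp
    then show ?thesis using gen[OF y(1)] y(2) by simp
  qed
  let ?f = "\<lambda>x. (\<chi> x, \<beta> x)"
  have "?f \<in> hom (m_fix M) (integer_group \<times>\<times> integer_group)"
    by (rule homI) (auto simp: \<beta>_mult)
  then have "(?f, \<psi>) \<in> mackey_hom p M (twisted_burnside p d)"
    using \<psi>.homh act by (auto simp: mackey_hom_def twisted_burnside_def \<beta> \<chi>_tr \<beta>_tr mult.commute)
  moreover have "bij_betw ?f (carrier (m_fix M)) UNIV"
    unfolding bij_betw_def
  proof
    show "inj_on ?f (carrier (m_fix M))"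
      using eq_tr by (intro inj_onI) (metis prod.inject)
    have "\<exists>x\<in>carrier (m_fix M). (a, c) = ?f x" for a c
    proof -
      let ?x = "v [^]\<^bsub>m_fix M\<^esub> a \<otimes>\<^bsub>m_fix M\<^esub> m_tr M (t [^]\<^bsub>m_und M\<^esub> c)"
      have x: "?x \<in> carrier (m_fix M)" using v t by simp
      have "\<chi> ?x = a"
        using v t by (simp add: group_hom_int_pow_add[OF \<chi>(1)] \<chi>_tr)
      moreover have "int p * \<beta> ?x = int p * c"
        using \<beta>[OF x] v t unfolding \<open>\<chi> ?x = a\<close>
        by (auto simp: M.res.hom_int_pow \<psi>_pow d_def res_tr)
      ultimately show ?thesis
        using x p1 by (intro bexI[of _ ?x]) auto
    qed
    then show "?f ` carrier (m_fix M) = UNIV"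
      by (auto simp: image_def)
  qed
  ultimately have "mackey_isomorphic p M (twisted_burnside p d)"
    using \<psi>(2) unfolding mackey_isomorphic_def
    by (intro bexI[of _ "(?f, \<psi>)"]) (auto simp: twisted_burnside_def)
  \<comment> \<open>Otherwise p would divide \<open>\<chi> x0 * d + int p * \<beta> x0\<close>,
    which is \<open>\<psi> (m_res M x0)\<close>.\<close>
  moreover have "\<not> int p dvd d"
    using \<beta>[OF x0(1)] x0(2) by auto
  then have "coprime (int p) d"
    using prime_p by (intro prime_imp_coprime) auto
  then have "gcd d (int p) = 1"
    by (simp add: coprime_iff_gcd_eq_1 gcd.commute)
  ultimately show ?thesis by (intro exI[of _ d] conjI)
qed

end

section \<open>Box products of twisted Burnside functors\<close>

text \<open>Coordinates on a Mackey functor isomorphic to a twisted Burnside functor: \<open>a\<close> and \<open>b\<close> are the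
  coefficients of $1$ and $[C_p]$, and \<open>c\<close> is the coordinate on the underlying group.\<close>

locale twisted_coordinates = cp_mackey p M
  for p :: nat and M :: "('a, 'b) mackey" +
  fixes d :: int and a b :: "'a \<Rightarrow> int" and c :: "'b \<Rightarrow> int"
  assumes hom: "(\<lambda>x. (a x, b x), c) \<in> mackey_hom p M (twisted_burnside p d)"
    and bij_ab: "bij_betw (\<lambda>x. (a x, b x)) (carrier (m_fix M)) UNIV"
    and bij_c: "bij_betw c (carrier (m_und M)) UNIV"
begin

lemma hom_ab: "(\<lambda>x. (a x, b x)) \<in> hom (m_fix M) (integer_group \<times>\<times> integer_group)"
  using hom by (simp add: mackey_hom_def twisted_burnside_def)

sublocale a: group_hom "m_fix M" integer_group a
  using hom_ab
  by (intro group_hom.intro group_hom_axioms.intro fx.group_axioms group_integer_group) (auto simp: hom_def)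

sublocale b: group_hom "m_fix M" integer_group b
  using hom_ab
  by (intro group_hom.intro group_hom_axioms.intro fx.group_axioms group_integer_group) (auto simp: hom_def)

sublocale c: group_hom "m_und M" integer_group c
  using hom by (intro group_hom.intro group_hom_axioms.intro ud.group_axioms group_integer_group)
    (auto simp: mackey_hom_def twisted_burnside_def)

lemma a_tr [simp]: "y \<in> carrier (m_und M) \<Longrightarrow> a (m_tr M y) = 0"
  and b_tr [simp]: "y \<in> carrier (m_und M) \<Longrightarrow> b (m_tr M y) = c y"
  and c_res [simp]: "x \<in> carrier (m_fix M) \<Longrightarrow> c (m_res M x) = a x * d + b x * int p"
  and c_act [simp]: "\<gamma> \<in> carrier Cp \<Longrightarrow> y \<in> carrier (m_und M) \<Longrightarrow> c (m_act M \<gamma> y) = c y"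
  using hom by (simp_all add: mackey_hom_def twisted_burnside_def)

text \<open>The element \<open>t\<close> generates the underlying group and \<open>u\<close>
  corresponds to 1. Since \<open>m_tr M t\<close> corresponds to [C_p], it generates the fixed group
  together with \<open>u\<close>.\<close>

definition t where "t = the_inv_into (carrier (m_und M)) c 1"
definition u where "u = the_inv_into (carrier (m_fix M)) (\<lambda>x. (a x, b x)) (1, 0)"

lemma t [simp]: "t \<in> carrier (m_und M)" "c t = 1"
  unfolding t_def
  using bij_c the_inv_into_into[of c "carrier (m_und M)" 1 "carrier (m_und M)"]
    f_the_inv_into_f[of c "carrier (m_und M)" 1]
  by (simp_all add: bij_betw_def)

lemma u [simp]: "u \<in> carrier (m_fix M)" "a u = 1" "b u = 0"
proof -
  have inj: "inj_on (\<lambda>x. (a x, b x)) (carrier (m_fix M))"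
    and 1: "(1, 0) \<in> (\<lambda>x. (a x, b x)) ` carrier (m_fix M)"
    using bij_ab by (simp_all add: bij_betw_def)
  show "u \<in> carrier (m_fix M)"
    unfolding u_def by (rule the_inv_into_into[OF inj 1 order_refl])
  show "a u = 1" "b u = 0"
    using f_the_inv_into_f[OF inj 1] by (simp_all add: u_def)
qed

lemma und_eq: "y \<in> carrier (m_und M) \<Longrightarrow> y = t [^]\<^bsub>m_und M\<^esub> c y"
  by (rule inj_onD[OF bij_betw_imp_inj_on[OF bij_c]])
    (simp_all add: group_hom_int_pow_add[OF c.group_hom_axioms])

lemma fix_eq: "x \<in> carrier (m_fix M) \<Longrightarrow> x = u [^]\<^bsub>m_fix M\<^esub> a x \<otimes>\<^bsub>m_fix M\<^esub> m_tr M t [^]\<^bsub>m_fix M\<^esub> b x"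
  by (rule inj_onD[OF bij_betw_imp_inj_on[OF bij_ab]])
    (simp_all add: group_hom_int_pow_add[OF a.group_hom_axioms] group_hom_int_pow_add[OF b.group_hom_axioms])

end

lemma mackey_isomorphic_twisted_coordinates:
  assumes "cp_mackey p M" "mackey_isomorphic p M (twisted_burnside p d)"
  obtains a b c where "twisted_coordinates p M d a b c"
proof -
  obtain f c where *: "(f, c) \<in> mackey_hom p M (twisted_burnside p d)"
    "bij_betw f (carrier (m_fix M)) UNIV" "bij_betw c (carrier (m_und M)) UNIV"
    using assms(2) by (auto simp: mackey_isomorphic_def twisted_burnside_def)
  then have "twisted_coordinates p M d (fst \<circ> f) (snd \<circ> f) c"
    by (intro twisted_coordinates.intro assms(1) twisted_coordinates_axioms.intro) simp_all
  then show thesis by (rule that)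
qed

section \<open>Coordinates on the box product of two twisted Burnside functors\<close>

locale twisted_pair =
  M: twisted_coordinates p M d a b c + N: twisted_coordinates p N d' a' b' c'
  for p :: nat and M :: "('a, 'b) mackey" and d a b c
    and N :: "('c, 'd) mackey" and d' a' b' c' +
  fixes k :: int
  assumes dd': "d * d' = 1 + int p * k"

sublocale twisted_pair \<subseteq> mackey_pair p M N
  by unfold_locales

context twisted_pair
begin

lemma und_coordinate:
  obtains g where "group_hom U integer_group g"
    "\<And>x y. x \<in> carrier (m_und M) \<Longrightarrow> y \<in> carrier (m_und N) \<Longrightarrow> g (undt.pure x y) = c x * c' y"
    "\<And>\<gamma> z. \<gamma> \<in> carrier M.Cp \<Longrightarrow> z \<in> carrier U \<Longrightarrow> g (act \<gamma> z) = g z"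
proof -
  have "bilinear_map (m_und M) (m_und N) integer_group (\<lambda>x y. c x * c' y)"
    by (auto simp: bilinear_map_def hom_def algebra_simps)
  then obtain g where g: "group_hom U integer_group g"
    "\<And>x y. x \<in> carrier (m_und M) \<Longrightarrow> y \<in> carrier (m_und N) \<Longrightarrow> g (undt.pure x y) = c x * c' y"
    using undt.tensor_universal[OF abelian_integer_group] by metis
  have "g (act \<gamma> z) = g z" if \<gamma>: "\<gamma> \<in> carrier M.Cp" and z: "z \<in> carrier U" for \<gamma> z
  proof -
    have "group_hom U integer_group (g \<circ> act \<gamma>)"
      using hom_compose[OF group_hom.homh[OF group_hom_act[OF \<gamma>]] group_hom.homh[OF g(1)]]
      by (intro group_hom.intro group_hom_axioms.intro undt.tensor.group_axioms group_integer_group)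
    then have "(g \<circ> act \<gamma>) z = g z"
      by (rule undt.tensor_hom_eqI[OF _ g(1) _ z])
        (use \<gamma> in \<open>simp add: act_pure g(2) M.act_closed N.act_closed\<close>)
    then show ?thesis by simp
  qed
  with g show thesis by (rule that)
qed

text \<open>Coefficients pull out of both slots of a pure tensor, leaving a power of
  \<open>undt.pure M.t N.t\<close>. Injectivity of \<open>g\<close> follows.\<close>

lemma und_box_generated:
  assumes "group_hom U integer_group g"
    "\<And>x y. x \<in> carrier (m_und M) \<Longrightarrow> y \<in> carrier (m_und N) \<Longrightarrow> g (undt.pure x y) = c x * c' y"
    and "z \<in> carrier U"
  shows "z = undt.pure M.t N.t [^]\<^bsub>U\<^esub> g z"
proof -
  interpret g: group_hom U integer_group g by fact
  have id: "group_hom U U (\<lambda>z. z)"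
    by unfold_locales (auto simp: hom_def)
  have pow: "group_hom U U (\<lambda>z. undt.pure M.t N.t [^]\<^bsub>U\<^esub> g z)"
    by unfold_locales (auto simp: hom_def undt.tensor.int_pow_mult)
  show ?thesis
  proof (rule undt.tensor_hom_eqI[OF id pow _ assms(3)])
    fix x y assume xy: "x \<in> carrier (m_und M)" "y \<in> carrier (m_und N)"
    have "undt.pure x y = undt.pure (M.t [^]\<^bsub>m_und M\<^esub> c x) (N.t [^]\<^bsub>m_und N\<^esub> c' y)"
      using M.und_eq N.und_eq xy by metis
    also have "\<dots> = undt.pure M.t (N.t [^]\<^bsub>m_und N\<^esub> c' y) [^]\<^bsub>U\<^esub> c x"
      by (rule group_hom.hom_int_pow[OF undt.group_hom_pure_right]) simp_all
    also have "undt.pure M.t (N.t [^]\<^bsub>m_und N\<^esub> c' y) = undt.pure M.t N.t [^]\<^bsub>U\<^esub> c' y"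
      by (rule group_hom.hom_int_pow[OF undt.group_hom_pure_left]) simp_all
    finally have "undt.pure x y = undt.pure M.t N.t [^]\<^bsub>U\<^esub> (c x * c' y)"
      by (simp add: undt.tensor.int_pow_pow mult.commute)
    then show "undt.pure x y = undt.pure M.t N.t [^]\<^bsub>U\<^esub> g (undt.pure x y)"
      unfolding assms(2)[OF xy] .
  qed
qed

text \<open>In the twisted functors these are 1 \<otimes> 1 and tr(1 \<otimes> 1), which generate
  the fixed group of the box product.\<close>

abbreviation W where "W \<equiv> bp M.u N.u"
abbreviation T where "T \<equiv> m_tr box (undt.pure M.t N.t)"

text \<open>Expansion in generators leaves the terms u \<otimes> tr(t), tr(t) \<otimes> u and tr(t)
  \<otimes> tr(t). Frobenius reciprocity turns them into d, d' and p times \<open>T\<close>; the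
  factors are the coordinates of res(u) in \<open>M\<close>, of res(u) in \<open>N\<close> and of
  res(tr(t)).\<close>

lemma bp_eq:
  assumes xy: "x \<in> carrier (m_fix M)" "y \<in> carrier (m_fix N)"
  shows "bp x y = W [^]\<^bsub>m_fix box\<^esub> (a x * a' y) \<otimes>\<^bsub>m_fix box\<^esub>
    T [^]\<^bsub>m_fix box\<^esub> (d * a x * b' y + d' * b x * a' y + int p * b x * b' y)"
proof -
  let ?B = "m_fix box"
  have left: "group_hom (m_fix N) ?B (bp x)" if "x \<in> carrier (m_fix M)" for x
    using bilinear_map_bp that unfolding bilinear_map_def
    by (intro group_hom.intro group_hom_axioms.intro N.fx.group_axioms fb.group_axioms) auto
  have right: "group_hom (m_fix M) ?B (\<lambda>x. bp x y)" if "y \<in> carrier (m_fix N)" for y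
    using bilinear_map_bp that unfolding bilinear_map_def
    by (intro group_hom.intro group_hom_axioms.intro M.fx.group_axioms fb.group_axioms) auto
  have pow: "m_tr box (undt.pure (M.t [^]\<^bsub>m_und M\<^esub> i) (N.t [^]\<^bsub>m_und N\<^esub> j)) = T [^]\<^bsub>?B\<^esub> (i * j)" for i j :: int
    by (simp add: group_hom.hom_int_pow[OF undt.group_hom_pure_left]
        group_hom.hom_int_pow[OF undt.group_hom_pure_right] trb.hom_int_pow fb.int_pow_pow mult.commute)
  have uT: "bp M.u (m_tr N N.t) = T [^]\<^bsub>?B\<^esub> d"
    using pow[of d 1] M.und_eq[of "m_res M M.u"] by (simp add: frobenius_left)
  have Tu: "bp (m_tr M M.t) N.u = T [^]\<^bsub>?B\<^esub> d'"
    using pow[of 1 d'] N.und_eq[of "m_res N N.u"] by (simp add: frobenius_right)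
  have TT: "bp (m_tr M M.t) (m_tr N N.t) = T [^]\<^bsub>?B\<^esub> int p"
    using pow[of "int p" 1] M.und_eq[of "m_res M (m_tr M M.t)"] by (simp add: frobenius_left)
  have "bp x y = bp (M.u [^]\<^bsub>m_fix M\<^esub> a x \<otimes>\<^bsub>m_fix M\<^esub> m_tr M M.t [^]\<^bsub>m_fix M\<^esub> b x)
    (N.u [^]\<^bsub>m_fix N\<^esub> a' y \<otimes>\<^bsub>m_fix N\<^esub> m_tr N N.t [^]\<^bsub>m_fix N\<^esub> b' y)"
    using M.fix_eq[OF xy(1)] N.fix_eq[OF xy(2)] by simp
  also have "\<dots> = (W [^]\<^bsub>?B\<^esub> a x \<otimes>\<^bsub>?B\<^esub> (T [^]\<^bsub>?B\<^esub> d') [^]\<^bsub>?B\<^esub> b x) [^]\<^bsub>?B\<^esub> a' y \<otimes>\<^bsub>?B\<^esub>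
      ((T [^]\<^bsub>?B\<^esub> d) [^]\<^bsub>?B\<^esub> a x \<otimes>\<^bsub>?B\<^esub> (T [^]\<^bsub>?B\<^esub> int p) [^]\<^bsub>?B\<^esub> b x) [^]\<^bsub>?B\<^esub> b' y"
    by (simp add: group_hom.hom_mult[OF right] group_hom.hom_int_pow[OF right]
        group_hom.hom_mult[OF left] group_hom.hom_int_pow[OF left] uT Tu TT)
  also have "\<dots> = W [^]\<^bsub>?B\<^esub> (a x * a' y) \<otimes>\<^bsub>?B\<^esub>
    T [^]\<^bsub>?B\<^esub> (d * a x * b' y + d' * b x * a' y + int p * b x * b' y)"
    by (simp add: fb.int_pow_distrib fb.int_pow_pow fb.m_assoc flip: fb.int_pow_mult)
      (simp add: algebra_simps)
  finally show ?thesis .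
qed

lemma box_isomorphic_burnside: "mackey_isomorphic p box (burnside p)"
proof -
  let ?B = "m_fix box" and ?Z2 = "integer_group \<times>\<times> integer_group"
  obtain g where g: "group_hom U integer_group g"
    and g_pure: "\<And>x y. x \<in> carrier (m_und M) \<Longrightarrow> y \<in> carrier (m_und N) \<Longrightarrow> g (undt.pure x y) = c x * c' y"
    and g_act: "\<And>\<gamma> z. \<gamma> \<in> carrier M.Cp \<Longrightarrow> z \<in> carrier U \<Longrightarrow> g (act \<gamma> z) = g z"
    using und_coordinate by metis
  interpret g: group_hom U integer_group g by fact
  have g_gen: "z = undt.pure M.t N.t [^]\<^bsub>U\<^esub> g z" if "z \<in> carrier U" for z
    by (rule und_box_generated[OF g g_pure]) (fact that | assumption)+
  have Z2: "comm_group ?Z2"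
    by (intro comm_group_DirProd abelian_integer_group)
  \<comment> \<open>\<open>W\<close> is to go to (1, k) and \<open>T\<close> to (0, 1); the other
    terms of the second coordinate are the exponent of \<open>T\<close> in
    \<open>bp_eq\<close>.\<close>
  define B where "B x y = (a x * a' y,
    k * a x * a' y + d * a x * b' y + d' * b x * a' y + int p * b x * b' y)" for x y
  have B: "bilinear_map (m_fix M) (m_fix N) ?Z2 B"
    by (auto simp: bilinear_map_def B_def hom_def algebra_simps)
  have g0: "group_hom U ?Z2 (\<lambda>z. (0, g z))"
    by (intro group_hom.intro group_hom_axioms.intro undt.tensor.group_axioms
        comm_group.axioms(2)[OF Z2] homI) auto
  have "\<exists>h. group_hom ?B ?Z2 h \<and>
      (\<forall>x\<in>carrier (m_fix M). \<forall>y\<in>carrier (m_fix N). h (bp x y) = B x y) \<and>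
      (\<forall>z\<in>carrier U. h (m_tr box z) = (0, g z))"
    by (rule box_universal[OF Z2 B g0]) (blast | simp add: g_act g_pure B_def algebra_simps)+
  then obtain h where h: "group_hom ?B ?Z2 h"
    and h_bp: "\<And>x y. x \<in> carrier (m_fix M) \<Longrightarrow> y \<in> carrier (m_fix N) \<Longrightarrow> h (bp x y) = B x y"
    and h_tr: "\<And>z. z \<in> carrier U \<Longrightarrow> h (m_tr box z) = (0, g z)"
    by blast
  interpret h: group_hom ?B ?Z2 h by fact
  define h1 where "h1 w = fst (h w)" for w
  define h2 where "h2 w = snd (h w)" for w
  have h1: "group_hom ?B integer_group h1" and h2: "group_hom ?B integer_group h2"
    unfolding h1_def h2_def by unfold_locales (auto simp: hom_def mult_DirProd')
  interpret h1: group_hom ?B integer_group h1 by fact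
  interpret h2: group_hom ?B integer_group h2 by fact
  interpret rb: group_hom ?B U "m_res box" by (rule group_hom_m_res_box)

  \<comment> \<open>The action is invisible to \<open>g\<close>, so the norm gives p equal
    summands.\<close>
  have g_norm: "g (norm z) = int p * g z" if z: "z \<in> carrier U" for z
  proof -
    have "g (norm z) = finprod integer_group (\<lambda>\<gamma>. g (act \<gamma> z)) (carrier M.Cp)"
      unfolding norm_eq
      by (rule undt.tensor.finprod_hom[OF abelian_integer_group g.homh]) (simp add: z)
    also have "\<dots> = finprod integer_group (\<lambda>\<gamma>. g z) (carrier M.Cp)"
      by (rule comm_monoid.finprod_cong'[OF comm_group.axioms(1)[OF abelian_integer_group]])
        (auto simp: g_act z)
    also have "\<dots> = int p * g z"
      using comm_monoid.finprod_const[OF comm_group.axioms(1)[OF abelian_integer_group], of "g z" "carrier M.Cp"]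
      by simp
    finally show ?thesis .
  qed
  have res: "g (m_res box w) = h1 w + h2 w * int p" if w: "w \<in> carrier ?B" for w
    using w
  proof (induction w rule: box_induct)
    case (pure x y)
    then have "g (m_res box (bp x y)) = (a x * d + b x * int p) * (a' y * d' + b' y * int p)"
      by (simp add: m_res_box_bp g_pure)
    also have "\<dots> = a x * a' y * (d * d') + int p * (d * a x * b' y + d' * b x * a' y + int p * b x * b' y)"
      by (simp add: algebra_simps)
    \<comment> \<open>The excess p k in \<open>d * d'\<close> is matched by the term with
      \<open>k\<close> in the second coordinate of \<open>B\<close>.\<close>
    also have "\<dots> = h1 (bp x y) + h2 (bp x y) * int p"
      unfolding dd' using pure by (simp add: h1_def h2_def h_bp B_def algebra_simps)
    finally show ?case .
  next
    case (tr z)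
    then show ?case by (simp add: m_res_box_tr g_norm h1_def h2_def h_tr)
  next
    case (diff v w)
    then show ?case by (simp add: algebra_simps)
  qed

  \<comment> \<open>As \<open>h\<close> sends \<open>W\<close> to (1, k) and \<open>T\<close> to (0,
    1), the preimage of (m, n) is m times \<open>W\<close> plus n - k m times
    \<open>T\<close>.\<close>
  define H where "H m n = W [^]\<^bsub>?B\<^esub> m \<otimes>\<^bsub>?B\<^esub> T [^]\<^bsub>?B\<^esub> (n - k * m)" for m n
  have WT: "W \<in> carrier ?B" "T \<in> carrier ?B" by simp_all
  \<comment> \<open>The left side is an endomorphism in \<open>w\<close>, so it is the identity once
    it fixes the elements \<open>bp x y\<close> and the transfers.\<close>
  have "H (h1 w) (h2 w) = w" if w: "w \<in> carrier ?B" for w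
  proof (rule sym, rule box_hom_eqI[where h = "\<lambda>w. w" and T = ?B])
    show "group_hom ?B ?B (\<lambda>w. w)"
      by unfold_locales (auto simp: hom_def)
    have "(\<lambda>w. H (h1 w) (h2 w)) \<in> hom ?B ?B"
    proof (rule homI)
      fix v w assume vw: "v \<in> carrier ?B" "w \<in> carrier ?B"
      have "T [^]\<^bsub>?B\<^esub> (h2 v + h2 w - k * (h1 v + h1 w)) =
          T [^]\<^bsub>?B\<^esub> (h2 v - k * h1 v) \<otimes>\<^bsub>?B\<^esub> T [^]\<^bsub>?B\<^esub> (h2 w - k * h1 w)"
        using fb.int_pow_mult[OF WT(2), of "h2 v - k * h1 v" "h2 w - k * h1 w"]
        by (simp add: algebra_simps)
      with vw WT show "H (h1 (v \<otimes>\<^bsub>?B\<^esub> w)) (h2 (v \<otimes>\<^bsub>?B\<^esub> w)) = H (h1 v) (h2 v) \<otimes>\<^bsub>?B\<^esub> H (h1 w) (h2 w)"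
        by (simp add: H_def fb.int_pow_mult fb.m_ac)
    qed (simp add: H_def)
    then show "group_hom ?B ?B (\<lambda>w. H (h1 w) (h2 w))"
      by unfold_locales
    show "bp x y = H (h1 (bp x y)) (h2 (bp x y))" if "x \<in> carrier (m_fix M)" "y \<in> carrier (m_fix N)" for x y
    proof -
      have "k * a x * a' y + d * a x * b' y + d' * b x * a' y + int p * b x * b' y - k * (a x * a' y) =
          d * a x * b' y + d' * b x * a' y + int p * b x * b' y"
        by simp
      then show ?thesis
        unfolding H_def h1_def h2_def h_bp[OF that] B_def fst_conv snd_conv
        using bp_eq[OF that] by (simp only:)
    qed
    show "m_tr box z = H (h1 (m_tr box z)) (h2 (m_tr box z))" if "z \<in> carrier U" for z
      using g_gen[OF that] that by (simp add: H_def h1_def h2_def h_tr flip: trb.hom_int_pow)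
  qed fact
  then have "inj_on h (carrier ?B)"
    by (intro inj_onI) (metis h1_def h2_def)
  moreover have "\<exists>w\<in>carrier ?B. (m, n) = h w" for m n
  proof (intro bexI[of _ "H m n"])
    have "h1 W = 1" "h2 W = k" "h1 T = 0" "h2 T = 1"
      by (simp_all add: h1_def h2_def h_bp h_tr B_def g_pure)
    then have "h1 (H m n) = m" "h2 (H m n) = n"
      by (simp_all add: H_def group_hom_int_pow_add[OF h1] group_hom_int_pow_add[OF h2] algebra_simps)
    then show "(m, n) = h (H m n)"
      by (simp add: h1_def h2_def prod_eq_iff)
  qed (simp add: H_def)
  then have "h ` carrier ?B = UNIV"
    by (auto simp: image_def)
  moreover have "inj_on g (carrier U)"
    using g_gen by (intro inj_onI) metis
  moreover have "\<exists>z\<in>carrier U. n = g z" for n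
    by (intro bexI[of _ "undt.pure M.t N.t [^]\<^bsub>U\<^esub> n"]) (simp_all add: group_hom_int_pow_add[OF g] g_pure)
  then have "g ` carrier U = UNIV"
    by (auto simp: image_def)
  moreover have "(h, g) \<in> mackey_hom p box (burnside p)"
    using h.homh g.homh
    by (auto simp: mackey_hom_def burnside_def twisted_burnside_def g_act res h_tr split_beta h1_def h2_def)
  ultimately show ?thesis
    unfolding mackey_isomorphic_def
    by (intro bexI[of _ "(h, g)"]) (auto simp: bij_betw_def burnside_def twisted_burnside_def)
qed

end

section \<open>Copies of twisted Burnside functors on given infinite types\<close>

lemma comm_group_image_group:
  assumes "comm_group G" "inj_on f (carrier G)"
  shows "comm_group (image_group f G)"
proof -
  interpret comm_group G by fact
  have "G \<cong> image_group f G"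
    using inj_imp_image_group_iso[OF assms(2)] by (auto simp: is_iso_def)
  then show ?thesis
    using inj_imp_image_group_is_group[OF assms(2)] group.is_monoid by (intro iso_imp_comm_group)
qed

lemma trivial_action_hom_AutoGroup:
  assumes "group G"
  shows "(\<lambda>_. restrict (\<lambda>y. y) (carrier G)) \<in> hom C (AutoGroup G)"
proof -
  interpret group "AutoGroup G" using assms by (rule group.AutoGroup)
  have "restrict (\<lambda>y. y) (carrier G) = \<one>\<^bsub>AutoGroup G\<^esub>"
    by (simp add: AutoGroup_def BijGroup_def)
  then show ?thesis by (auto simp: hom_def)
qed

lemma infinite_UNIV_inj_countable:
  assumes "infinite (UNIV :: 'c set)"
  obtains f :: "'i :: countable \<Rightarrow> 'c" where "inj f"
proof -
  obtain f :: "nat \<Rightarrow> 'c" where "inj f"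
    using assms infinite_countable_subset by blast
  then have "inj (f \<circ> (to_nat :: 'i \<Rightarrow> nat))"
    by (intro inj_compose) auto
  then show thesis by (rule that)
qed

text \<open>The candidate inverse has to live on prescribed types. An infinite type contains a copy
  of any countable one, here the integers or pairs of integers, and the structure is transported
  along such injections.\<close>

lemma twisted_burnside_copy:
  assumes "p > 0" "infinite (UNIV :: 'c set)" "infinite (UNIV :: 'd set)"
  obtains N :: "('c, 'd) mackey"
  where "mackey_functor p N" "mackey_isomorphic p N (twisted_burnside p d)"
proof -
  obtain i :: "int \<times> int \<Rightarrow> 'c" where i: "inj i"
    using infinite_UNIV_inj_countable[OF assms(2)] by blast
  obtain j :: "int \<Rightarrow> 'd" where j: "inj j"
    using infinite_UNIV_inj_countable[OF assms(3)] by blast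
  let ?Z2 = "integer_group \<times>\<times> integer_group"
  define N :: "('c, 'd) mackey" where "N = \<lparr>
     m_fix = image_group i ?Z2,
     m_und = image_group j integer_group,
     m_act = (\<lambda>\<gamma> n. n),
     m_tr = (\<lambda>y. i (0, Hilbert_Choice.inv j y)),
     m_res = (\<lambda>x. j (fst (Hilbert_Choice.inv i x) * d + snd (Hilbert_Choice.inv i x) * int p))\<rparr>"
  have carr: "carrier (image_group i ?Z2) = range i" "carrier (image_group j integer_group) = range j"
    by (simp_all add: image_group_carrier)
  have mult: "i v \<otimes>\<^bsub>image_group i ?Z2\<^esub> i w = i (fst v + fst w, snd v + snd w)"
    "j m \<otimes>\<^bsub>image_group j integer_group\<^esub> j n = j (m + n)" for v w m n
    using i j by (simp_all add: image_group_def mult_DirProd')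
  have comm: "comm_group (m_fix N)" "comm_group (m_und N)"
    using comm_group_image_group[OF comm_group_DirProd[OF abelian_integer_group abelian_integer_group], of i]
      comm_group_image_group[OF abelian_integer_group, of j] i j
    by (simp_all add: N_def)
  interpret f: comm_group "m_fix N" by fact
  interpret u: comm_group "m_und N" by fact
  have jh: "j \<in> hom integer_group (m_und N)"
    by (auto simp: hom_def N_def carr mult)
  interpret jh: group_hom integer_group "m_und N" j
    using jh by (intro group_hom.intro group_hom_axioms.intro group_integer_group u.group_axioms)
  have fin: "finprod (m_und N) (\<lambda>\<gamma>. j n) (carrier (integer_mod_group p)) = j (n * int p)" for n
    using u.finprod_const[of "j n" "carrier (integer_mod_group p)"] jh.hom_nat_pow[of n p] assms(1)
    by (simp add: carrier_integer_mod_group mult.commute)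
  have res_tr: "m_res N (m_tr N y) = finprod (m_und N) (\<lambda>\<gamma>. m_act N \<gamma> y) (carrier (integer_mod_group p))"
    if "y \<in> carrier (m_und N)" for y
  proof -
    have "y \<in> range j"
      using that by (simp add: N_def carr)
    then obtain n where y: "y = j n"
      by blast
    show ?thesis
      using fin[of n] unfolding y by (simp add: N_def i j)
  qed
  have act: "(\<lambda>\<gamma>. restrict (m_act N \<gamma>) (carrier (m_und N))) \<in> hom (integer_mod_group p) (AutoGroup (m_und N))"
    using trivial_action_hom_AutoGroup[OF u.group_axioms] by (simp add: N_def)
  have hom: "m_tr N \<in> hom (m_und N) (m_fix N)" "m_res N \<in> hom (m_fix N) (m_und N)"
    using i j by (auto simp: hom_def N_def carr mult algebra_simps)
  have "mackey_functor p N"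
    unfolding mackey_functor_def using comm act hom res_tr by (auto simp: N_def)
  moreover have "(Hilbert_Choice.inv i, Hilbert_Choice.inv j) \<in> mackey_hom p N (twisted_burnside p d)"
    using i j by (auto simp: mackey_hom_def twisted_burnside_def hom_def N_def carr mult split_beta)
  moreover have "bij_betw (Hilbert_Choice.inv i) (range i) UNIV" "bij_betw (Hilbert_Choice.inv j) (range j) UNIV"
    using i j by (simp_all add: bij_betw_inv_into inj_imp_bij_betw_inv)
  ultimately show thesis
    by (intro that[of N])
      (auto simp: mackey_isomorphic_def N_def carr twisted_burnside_def intro!: bexI[of _ "(Hilbert_Choice.inv i, Hilbert_Choice.inv j)"])
qed

theorem theorem4p19:
  fixes p :: nat and M :: "('a, 'b) mackey"
  assumes "prime p"
    and "mackey_functor p M"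
    and "infinite (UNIV :: 'c set)"
    and "infinite (UNIV :: 'd set)"
  shows "mackey_invertible TYPE('c) TYPE('d) p M \<longleftrightarrow>
    (\<exists>d :: int. gcd d (int p) = 1 \<and> mackey_isomorphic p M (twisted_burnside p d))"
proof
  have p: "p > 0"
    using assms(1) by (rule prime_gt_0_nat)
  have M: "cp_mackey p M"
    using p assms(2) by (rule cp_mackey.intro)
  {
    assume "mackey_invertible TYPE('c) TYPE('d) p M"
    then obtain N :: "('c, 'd) mackey" and f g where "mackey_functor p N"
      and fg: "(f, g) \<in> mackey_hom p (mackey_box p M N) (burnside p)"
        "bij_betw f (carrier (m_fix (mackey_box p M N))) (carrier (m_fix (burnside p)))"
        "bij_betw g (carrier (m_und (mackey_box p M N))) (carrier (m_und (burnside p)))"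
      unfolding mackey_invertible_def mackey_isomorphic_def by blast
    then have "cp_mackey p N"
      using p by (intro cp_mackey.intro)
    with M have "mackey_inverse p M N f g"
      using assms(1) fg by (intro mackey_inverse.intro mackey_pair.intro mackey_inverse_axioms.intro)
    then show "\<exists>d :: int. gcd d (int p) = 1 \<and> mackey_isomorphic p M (twisted_burnside p d)"
      by (rule mackey_inverse.M_isomorphic_twisted_burnside)
  next
    assume "\<exists>d :: int. gcd d (int p) = 1 \<and> mackey_isomorphic p M (twisted_burnside p d)"
    then obtain d :: int where d: "gcd d (int p) = 1" "mackey_isomorphic p M (twisted_burnside p d)"
      by metis
    \<comment> \<open>Bezout provides an inverse \<open>e\<close> of \<open>d\<close> modulo p; the
      constant k is then \<open>- l\<close>.\<close>
    obtain e l where "e * d + l * int p = 1"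
      using bezout_int[of d "int p"] d(1) by metis
    then have ed: "d * e = 1 + int p * (- l)"
      by (simp add: algebra_simps)
    obtain N :: "('c, 'd) mackey"
      where N: "mackey_functor p N" "mackey_isomorphic p N (twisted_burnside p e)"
      by (rule twisted_burnside_copy[OF p assms(3,4)])
    have "cp_mackey p N"
      using p N(1) by (rule cp_mackey.intro)
    then obtain a b c a' b' c' where "twisted_coordinates p M d a b c" "twisted_coordinates p N e a' b' c'"
      using mackey_isomorphic_twisted_coordinates[OF M d(2)]
        mackey_isomorphic_twisted_coordinates[OF _ N(2)] by metis
    then have "twisted_pair p M d a b c N e a' b' c' (- l)"
      using ed by (intro twisted_pair.intro twisted_pair_axioms.intro)
    then have "mackey_isomorphic p (mackey_box p M N) (burnside p)"
      by (rule twisted_pair.box_isomorphic_burnside)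
    with N(1) show "mackey_invertible TYPE('c) TYPE('d) p M"
      unfolding mackey_invertible_def by blast
  }
qed

end
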